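(* Let $M$ be an almost hyper-Hermitian manifold of dimension $4n$, $n\ge2$, with almost complex structures $I,J,K$. If one of the following conditions holds, then $M$ is hyperKähler: (i) $\nabla\omega_I,\nabla\omega_J,\nabla\omega_K\in\mathcal W_1+\mathcal W_2$; (ii) $\nabla\omega_I\in\mathcal W_1$ and $\nabla\omega_J\in\mathcal W_2$; (iii) $\nabla\omega_I=0$ and $\nabla\omega_J\in\mathcal W_1+\mathcal W_2$; (iv) $\nabla\omega_I\in\mathcal C$ and $\nabla\omega_J\in\mathcal W_4$, where $\mathcal C$ is one of $\mathcal W_1,\mathcal W_2,\mathcal W_3$; (v) $\nabla\omega_I=0$ and $\nabla\omega_J\in\mathcal C+\mathcal W_4$, where $\mathcal C$ is one of $\mathcal W_1,\mathcal W_2,\mathcal W_3$; (vi) $\nabla\omega_I=0$, $\nabla\omega_J\in\mathcal W_1+\mathcal W_2+\mathcal W_4$ and $\nabla\omega_K\in\mathcal C+\mathcal W_3$, where $\mathcal C$ is one of $\mathcal W_1+\mathcal W_2$, $\mathcal W_1+\mathcal W_4$, $\mathcal W_2+\mathcal W_4$; (vii) $\nabla\omega_I=0$, $\nabla\omega_J\in\mathcal W_1+\mathcal W_3+\mathcal W_4$ and $\nabla\omega_K\in\mathcal W_2+\mathcal W_3+\mathcal W_4$. Moreover, if $M$ is eight-dimensional, each one of the following conditions also implies that $M$ is hyperKähler: (viii) $\nabla\omega_I\in\mathcal W_1$ and $\nabla\omega_J\in\mathcal W_3$; (ix) $\nabla\omega_I=0$ and $\nabla\omega_J\in\mathcal W_1+\mathcal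 W_3$; (x) $\nabla\omega_I=0$, $\nabla\omega_J\in\mathcal W_1+\mathcal W_2+\mathcal W_3$ and $\nabla\omega_K\in\mathcal W_1+\mathcal W_3+\mathcal W_4$.
   Context: An almost hyper-Hermitian manifold is a smooth manifold $M$ of dimension $4n$, $n\ge2$, with a Riemannian metric $\langle\cdot,\cdot\rangle$ and global endomorphism fields $I,J,K$ of $TM$ satisfying $I^2=J^2=-1$, $K=IJ=-JI$ and $\langle AX,AY\rangle=\langle X,Y\rangle$ for $A=I,J,K$. Put $\omega_A(X,Y)=\langle X,AY\rangle$, let $\nabla$ be the Levi-Civita connection, and regard $\nabla\omega_A$ as the $(0,3)$-tensor $(X,Y,Z)\mapsto(\nabla_X\omega_A)(Y,Z)$. $M$ is hyperKähler if $\nabla\omega_I=\nabla\omega_J=\nabla\omega_K=0$. Gray-Hervella classes: for $A\in\{I,J,K\}$, $\nabla\omega_A$ takes values in $\mathcal W^A=\{b\in T^*M\otimes\Lambda^2T^*M: b(X,AY,AZ)=-b(X,Y,Z)\}$, and $\mathcal W^A=\mathcal W_1\oplus\mathcal W_2\oplus\mathcal W_3\oplus\mathcal W_4$ (orthogonal), where, with $\{e_i\}$ an orthonormal basis, $\mathcal W_1$: $b(X,X,Z)=0$ for all $X,Z$; $\mathcal W_2$: $b(X,Y,Z)+b(Y,Z,X)+b(Z,X,Y)=0$; $\mathcal W_3$: $b(AX,AY,Z)=b(X,Y,Z)$ and $\sum_i b(e_i,e_i,Z)=0$; $\mathcal W_4$: $b(X,Y,Z)=\langle X,Y\rangle\beta(Z)-\langle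 X,Z\rangle\beta(Y)-\langle X,AY\rangle\beta(AZ)+\langle X,AZ\rangle\beta(AY)$ for some one-form $\beta$. The statement $\nabla\omega_A\in\mathcal W_{i_1}+\dots+\mathcal W_{i_k}$ means that at every point $\nabla\omega_A$ lies in the indicated sum of the spaces $\mathcal W_i$ defined using $A$ itself. *)

theory Defs
  imports "HOL-Analysis.Analysis" "HOL-Library.Function_Algebras" "HOL-Library.Set_Algebras"
begin

section \<open>Smooth manifolds\<close>

text \<open>Meant for open \<open>S\<close> only: the derivatives are two-sided.\<close>

primrec C_k_on :: "nat \<Rightarrow> ('a::euclidean_space \<Rightarrow> 'b::real_normed_vector) \<Rightarrow> 'a set \<Rightarrow> bool" where
  "C_k_on 0 f S \<longleftrightarrow> continuous_on S f"
| "C_k_on (Suc k) f S \<longleftrightarrow>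
     (\<forall>x\<in>S. f differentiable (at x)) \<and> (\<forall>v. C_k_on k (\<lambda>x. frechet_derivative f (at x) v) S)"

definition smooth_on :: "'a::euclidean_space set \<Rightarrow> ('a \<Rightarrow> 'b::real_normed_vector) \<Rightarrow> bool" where
  "smooth_on S f \<longleftrightarrow> (\<forall>k. C_k_on k f S)"

text \<open>A chart is a subset of the manifold together with coordinates on it; the values of
  \<^term>\<open>chart_map c\<close> outside \<^term>\<open>chart_domain c\<close> are irrelevant.\<close>

datatype ('m, 'e) chart = Chart (chart_domain: "'m set") (chart_map: "'m \<Rightarrow> 'e")

definition chart_image :: "('m, 'e) chart \<Rightarrow> 'e set" where
  "chart_image c = chart_map c ` chart_domain c"

definition overlap :: "('m, 'e) chart \<Rightarrow> ('m, 'e) chart \<Rightarrow> 'e set" where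
  "overlap c d = chart_map c ` (chart_domain c \<inter> chart_domain d)"

definition transition :: "('m, 'e) chart \<Rightarrow> ('m, 'e) chart \<Rightarrow> 'e \<Rightarrow> 'e" where
  "transition c d x = chart_map d (inv_into (chart_domain c) (chart_map c) x)"

definition jacobian :: "('m, 'e::euclidean_space) chart \<Rightarrow> ('m, 'e) chart \<Rightarrow> 'e \<Rightarrow> 'e \<Rightarrow> 'e" where
  "jacobian c d x = frechet_derivative (transition c d) (at x)"

text \<open>The model space \<open>'e\<close> is a Euclidean space, so the dimension of the manifold is
  \<^term>\<open>DIM('e::euclidean_space)\<close>.\<close>

locale smooth_manifold =
  fixes M :: "'m topology" and atlas :: "('m, 'e::euclidean_space) chart set"
  assumes Hausdorff: "Hausdorff_space M"
    and second_countable: "second_countable M"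
    and covers: "(\<Union>c\<in>atlas. chart_domain c) = topspace M"
    and open_domain: "c \<in> atlas \<Longrightarrow> openin M (chart_domain c)"
    and open_image: "c \<in> atlas \<Longrightarrow> open (chart_image c)"
    and homeomorphic: "c \<in> atlas \<Longrightarrow>
      homeomorphic_map (subtopology M (chart_domain c)) (top_of_set (chart_image c)) (chart_map c)"
    and compatible: "c \<in> atlas \<Longrightarrow> d \<in> atlas \<Longrightarrow> smooth_on (overlap c d) (transition c d)"

section \<open>Tensor fields and connections in coordinates\<close>

text \<open>A tensor field is given classically, by its components in all charts, subject to the
  transformation law. A tangent vector at the point with coordinates \<open>x\<close> in the chart \<open>c\<close>
  is represented by a vector \<open>v :: 'e\<close>; its representative in the chart \<open>d\<close> is
  \<^term>\<open>jacobian c d x v\<close>. Thus \<open>g c x u v\<close> is the value of a (0,2)-tensor field on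
  the tangent vectors represented by \<open>u\<close> and \<open>v\<close>, and \<open>A c x v\<close> represents the value of an
  endomorphism field.\<close>

type_synonym ('m, 'e) tensor2 = "('m, 'e) chart \<Rightarrow> 'e \<Rightarrow> 'e \<Rightarrow> 'e \<Rightarrow> real"
type_synonym ('m, 'e) endomorphism = "('m, 'e) chart \<Rightarrow> 'e \<Rightarrow> 'e \<Rightarrow> 'e"
type_synonym ('m, 'e) christoffel = "('m, 'e) chart \<Rightarrow> 'e \<Rightarrow> 'e \<Rightarrow> 'e \<Rightarrow> 'e"

definition tensor2_field :: "('m, 'e::euclidean_space) chart set \<Rightarrow> ('m, 'e) tensor2 \<Rightarrow> bool" where
  "tensor2_field atlas g \<longleftrightarrow>
     (\<forall>c\<in>atlas. \<forall>x\<in>chart_image c. bilinear (g c x)) \<and>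
     (\<forall>c\<in>atlas. \<forall>u v. smooth_on (chart_image c) (\<lambda>x. g c x u v)) \<and>
     (\<forall>c\<in>atlas. \<forall>d\<in>atlas. \<forall>x\<in>overlap c d. \<forall>u v.
        g d (transition c d x) (jacobian c d x u) (jacobian c d x v) = g c x u v)"

definition endomorphism_field ::
  "('m, 'e::euclidean_space) chart set \<Rightarrow> ('m, 'e) endomorphism \<Rightarrow> bool" where
  "endomorphism_field atlas A \<longleftrightarrow>
     (\<forall>c\<in>atlas. \<forall>x\<in>chart_image c. linear (A c x)) \<and>
     (\<forall>c\<in>atlas. \<forall>v. smooth_on (chart_image c) (\<lambda>x. A c x v)) \<and>
     (\<forall>c\<in>atlas. \<forall>d\<in>atlas. \<forall>x\<in>overlap c d. \<forall>v.
        A d (transition c d x) (jacobian c d x v) = jacobian c d x (A c x v))"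

definition riemannian_metric ::
  "('m, 'e::euclidean_space) chart set \<Rightarrow> ('m, 'e) tensor2 \<Rightarrow> bool" where
  "riemannian_metric atlas g \<longleftrightarrow>
     tensor2_field atlas g \<and>
     (\<forall>c\<in>atlas. \<forall>x\<in>chart_image c.
        (\<forall>u v. g c x u v = g c x v u) \<and> (\<forall>v. v \<noteq> 0 \<longrightarrow> g c x v v > 0))"

text \<open>An affine connection \<open>\<nabla>\<close> is given by its Christoffel symbols: \<open>\<Gamma> c x u v\<close> represents
  \<open>\<nabla>\<^sub>u V\<close> at \<open>x\<close>, where \<open>V\<close> is the local vector field with constant representative \<open>v\<close> in the
  chart \<open>c\<close>; so \<open>(\<nabla>\<^sub>U V)(x) = DV(x)(U(x)) + \<Gamma> c x (U(x)) (V(x))\<close> for general \<open>U\<close> and \<open>V\<close>.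
  The second derivative of the transition map in the transformation law arises because \<open>V\<close> need
  not be constant in another chart \<open>d\<close>.\<close>

definition affine_connection ::
  "('m, 'e::euclidean_space) chart set \<Rightarrow> ('m, 'e) christoffel \<Rightarrow> bool" where
  "affine_connection atlas \<Gamma> \<longleftrightarrow>
     (\<forall>c\<in>atlas. \<forall>x\<in>chart_image c. bilinear (\<Gamma> c x)) \<and>
     (\<forall>c\<in>atlas. \<forall>u v. smooth_on (chart_image c) (\<lambda>x. \<Gamma> c x u v)) \<and>
     (\<forall>c\<in>atlas. \<forall>d\<in>atlas. \<forall>x\<in>overlap c d. \<forall>u v.
        jacobian c d x (\<Gamma> c x u v) =
        \<Gamma> d (transition c d x) (jacobian c d x u) (jacobian c d x v) +
        frechet_derivative (\<lambda>y. jacobian c d y v) (at x) u)"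

text \<open>The component \<open>(\<nabla>\<^sub>X b)(Y, Z) = X(b(Y, Z)) - b(\<nabla>\<^sub>X Y, Z) - b(Y, \<nabla>\<^sub>X Z)\<close> in the chart \<open>c\<close>
  at \<open>x\<close>, with \<open>Y\<close> and \<open>Z\<close> extended to have constant representatives.\<close>

definition nabla ::
  "('m, 'e::euclidean_space) christoffel \<Rightarrow> ('m, 'e) tensor2 \<Rightarrow>
   ('m, 'e) chart \<Rightarrow> 'e \<Rightarrow> 'e \<Rightarrow> 'e \<Rightarrow> 'e \<Rightarrow> real" where
  "nabla \<Gamma> b c x X Y Z =
     frechet_derivative (\<lambda>y. b c y Y Z) (at x) X - b c x (\<Gamma> c x X Y) Z - b c x Y (\<Gamma> c x X Z)"

text \<open>Torsion-free (coordinate vector fields commute) and metric.\<close>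

definition levi_civita ::
  "('m, 'e::euclidean_space) chart set \<Rightarrow> ('m, 'e) tensor2 \<Rightarrow> ('m, 'e) christoffel \<Rightarrow> bool" where
  "levi_civita atlas g \<Gamma> \<longleftrightarrow>
     affine_connection atlas \<Gamma> \<and>
     (\<forall>c\<in>atlas. \<forall>x\<in>chart_image c. \<forall>u v. \<Gamma> c x u v = \<Gamma> c x v u) \<and>
     (\<forall>c\<in>atlas. \<forall>x\<in>chart_image c. \<forall>X Y Z. nabla \<Gamma> g c x X Y Z = 0)"

section \<open>Almost hyper-Hermitian manifolds\<close>

locale almost_hyper_hermitian = smooth_manifold M atlas
  for M :: "'m topology" and atlas :: "('m, 'e::euclidean_space) chart set" +
  fixes g :: "('m, 'e) tensor2" and I J K :: "('m, 'e) endomorphism"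
  assumes metric: "riemannian_metric atlas g"
    and endomorphisms: "endomorphism_field atlas I" "endomorphism_field atlas J"
      "endomorphism_field atlas K"
    and I_squared: "\<And>c x v. c \<in> atlas \<Longrightarrow> x \<in> chart_image c \<Longrightarrow> I c x (I c x v) = - v"
    and J_squared: "\<And>c x v. c \<in> atlas \<Longrightarrow> x \<in> chart_image c \<Longrightarrow> J c x (J c x v) = - v"
    and K_eq: "\<And>c x v. c \<in> atlas \<Longrightarrow> x \<in> chart_image c \<Longrightarrow> K c x v = I c x (J c x v)"
      "\<And>c x v. c \<in> atlas \<Longrightarrow> x \<in> chart_image c \<Longrightarrow> K c x v = - J c x (I c x v)"
    and hermitian: "\<And>A c x u v. A \<in> {I, J, K} \<Longrightarrow> c \<in> atlas \<Longrightarrow> x \<in> chart_image c \<Longrightarrow>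
      g c x (A c x u) (A c x v) = g c x u v"

definition omega ::
  "('m, 'e) tensor2 \<Rightarrow> ('m, 'e) endomorphism \<Rightarrow> ('m, 'e) tensor2" where
  "omega g A c x X Y = g c x X (A c x Y)"

definition nabla_omega_zero ::
  "('m, 'e::euclidean_space) chart set \<Rightarrow> ('m, 'e) christoffel \<Rightarrow> ('m, 'e) tensor2 \<Rightarrow>
   ('m, 'e) endomorphism \<Rightarrow> bool" where
  "nabla_omega_zero atlas \<Gamma> g A \<longleftrightarrow>
     (\<forall>c\<in>atlas. \<forall>x\<in>chart_image c. \<forall>X Y Z. nabla \<Gamma> (omega g A) c x X Y Z = 0)"

definition hyperkaehler ::
  "('m, 'e::euclidean_space) chart set \<Rightarrow> ('m, 'e) christoffel \<Rightarrow> ('m, 'e) tensor2 \<Rightarrow>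
   ('m, 'e) endomorphism \<Rightarrow> ('m, 'e) endomorphism \<Rightarrow> ('m, 'e) endomorphism \<Rightarrow> bool" where
  "hyperkaehler atlas \<Gamma> g I J K \<longleftrightarrow>
     nabla_omega_zero atlas \<Gamma> g I \<and> nabla_omega_zero atlas \<Gamma> g J \<and> nabla_omega_zero atlas \<Gamma> g K"

section \<open>Gray-Hervella classes\<close>

text \<open>Here \<open>h\<close> is the inner product and \<open>A\<close> the complex structure of a single tangent space.\<close>

type_synonym 'e gray_hervella = "('e \<Rightarrow> 'e \<Rightarrow> real) \<Rightarrow> ('e \<Rightarrow> 'e) \<Rightarrow> ('e \<Rightarrow> 'e \<Rightarrow> 'e \<Rightarrow> real) set"

definition WW :: "('e::euclidean_space \<Rightarrow> 'e) \<Rightarrow> ('e \<Rightarrow> 'e \<Rightarrow> 'e \<Rightarrow> real) set" where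
  "WW A = {b. (\<forall>X. bilinear (b X)) \<and> (\<forall>Y Z. linear (\<lambda>X. b X Y Z)) \<and>
              (\<forall>X Y Z. b X Z Y = - b X Y Z) \<and>
              (\<forall>X Y Z. b X (A Y) (A Z) = - b X Y Z)}"

definition orthonormal_basis :: "('e::euclidean_space \<Rightarrow> 'e \<Rightarrow> real) \<Rightarrow> 'e set \<Rightarrow> bool" where
  "orthonormal_basis h E \<longleftrightarrow>
     finite E \<and> span E = UNIV \<and> (\<forall>u\<in>E. \<forall>v\<in>E. h u v = (if u = v then 1 else 0))"

definition W1 :: "'e::euclidean_space gray_hervella" where
  "W1 h A = {b \<in> WW A. \<forall>X Z. b X X Z = 0}"

definition W2 :: "'e::euclidean_space gray_hervella" where
  "W2 h A = {b \<in> WW A. \<forall>X Y Z. b X Y Z + b Y Z X + b Z X Y = 0}"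

definition W3 :: "'e::euclidean_space gray_hervella" where
  "W3 h A = {b \<in> WW A. (\<forall>X Y Z. b (A X) (A Y) Z = b X Y Z) \<and>
                        (\<forall>E Z. orthonormal_basis h E \<longrightarrow> (\<Sum>e\<in>E. b e e Z) = 0)}"

definition W4 :: "'e::euclidean_space gray_hervella" where
  "W4 h A = {b \<in> WW A. \<exists>\<beta>. linear \<beta> \<and> (\<forall>X Y Z. b X Y Z =
      h X Y * \<beta> Z - h X Z * \<beta> Y - h X (A Y) * \<beta> (A Z) + h X (A Z) * \<beta> (A Y))}"

text \<open>Sums such as \<^term>\<open>W1 + W2\<close> are formed pointwise in \<open>h\<close> and \<open>A\<close>, where they are sums
  of sets of tensors, and addition of tensors is again pointwise:\<close>

lemma gray_hervella_sum:
  fixes U V :: "'e gray_hervella"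
  shows "b \<in> (U + V) h A \<longleftrightarrow>
    (\<exists>b1\<in>U h A. \<exists>b2\<in>V h A. b = (\<lambda>X Y Z. b1 X Y Z + b2 X Y Z))"
  by (auto simp: set_plus_def plus_fun_def)

definition nabla_omega_in ::
  "('m, 'e::euclidean_space) chart set \<Rightarrow> ('m, 'e) christoffel \<Rightarrow> ('m, 'e) tensor2 \<Rightarrow>
   ('m, 'e) endomorphism \<Rightarrow> 'e gray_hervella \<Rightarrow> bool" where
  "nabla_omega_in atlas \<Gamma> g A W \<longleftrightarrow>
     (\<forall>c\<in>atlas. \<forall>x\<in>chart_image c. nabla \<Gamma> (omega g A) c x \<in> W (g c x) (A c x))"

end

theory Submission
  imports Defs
begin

text \<open>The problem is pointwise. The skew endomorphisms anticommuting with \<open>I\<close> are \<open>J s + K t\<close> with \<open>s\<close>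
  and \<open>t\<close> symmetric and commuting with \<open>I\<close>, \<open>J\<close>, \<open>K\<close>, so \<open>\<nabla>I\<close>, \<open>\<nabla>J\<close>, \<open>\<nabla>K\<close> are encoded by three
  one-forms \<open>S\<close>, \<open>T\<close>, \<open>U\<close> with values in such symmetric endomorphisms:
  \<open>\<nabla>I = J U - K T\<close>, \<open>\<nabla>J = K S - I U\<close>, \<open>\<nabla>K = I T - J S\<close>. Membership of \<open>\<nabla>\<omega>\<^sub>I\<close> in \<open>W1 + W2\<close> or
  \<open>W3 + W4\<close> says \<open>U = T \<circ> I\<close> or \<open>U = - T \<circ> I\<close>, and cyclically. This leaves a single one-form, hence
  expressions for all three tensors in terms of one of them. If that one is totally skew, some component
  of another one is totally skew too and is killed by a cyclic sum. If it is of type \<open>W4\<close>, an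
  evaluation on suitable vectors or a trace shows that its one-form \<open>\<beta>\<close> vanishes. In dimension eight a
  totally skew tensor of the relevant kind is determined by a contraction, which is a trace of
  \<open>\<nabla>\<omega>\<^sub>J\<close>.\<close>

section \<open>Trilinear forms\<close>

definition trilinear :: "('e::euclidean_space \<Rightarrow> 'e \<Rightarrow> 'e \<Rightarrow> real) \<Rightarrow> bool" where
  "trilinear b \<longleftrightarrow> (\<forall>X. bilinear (b X)) \<and> (\<forall>Y Z. linear (\<lambda>X. b X Y Z))"

lemma trilinear_iff:
  "trilinear b \<longleftrightarrow> (\<forall>Y Z. linear (\<lambda>X. b X Y Z)) \<and> (\<forall>X Z. linear (\<lambda>Y. b X Y Z)) \<and>
     (\<forall>X Y. linear (\<lambda>Z. b X Y Z))"
  unfolding trilinear_def bilinear_def by auto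

lemma
  assumes "trilinear b"
  shows trilinear_add: "b (X + X') Y Z = b X Y Z + b X' Y Z" "b X (Y + Y') Z = b X Y Z + b X Y' Z"
      "b X Y (Z + Z') = b X Y Z + b X Y Z'"
    and trilinear_minus: "b (- X) Y Z = - b X Y Z" "b X (- Y) Z = - b X Y Z"
      "b X Y (- Z) = - b X Y Z"
    and trilinear_scaleR: "b (a *\<^sub>R X) Y Z = a * b X Y Z" "b X (a *\<^sub>R Y) Z = a * b X Y Z"
      "b X Y (a *\<^sub>R Z) = a * b X Y Z"
    and trilinear_zero: "b 0 Y Z = 0" "b X 0 Z = 0" "b X Y 0 = 0"
    and trilinear_diff: "b (X - X') Y Z = b X Y Z - b X' Y Z" "b X (Y - Y') Z = b X Y Z - b X Y' Z"
      "b X Y (Z - Z') = b X Y Z - b X Y Z'"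
proof -
  have l: "linear (\<lambda>X. b X Y Z)" "linear (\<lambda>Y. b X Y Z)" "linear (\<lambda>Z. b X Y Z)" for X Y Z
    using assms unfolding trilinear_iff by auto
  show "b (X + X') Y Z = b X Y Z + b X' Y Z" "b X (Y + Y') Z = b X Y Z + b X Y' Z"
    "b X Y (Z + Z') = b X Y Z + b X Y Z'"
    using l[THEN linear_add] by auto
  show "b (- X) Y Z = - b X Y Z" "b X (- Y) Z = - b X Y Z" "b X Y (- Z) = - b X Y Z"
    using l[THEN linear_neg] by auto
  show "b (a *\<^sub>R X) Y Z = a * b X Y Z" "b X (a *\<^sub>R Y) Z = a * b X Y Z"
    "b X Y (a *\<^sub>R Z) = a * b X Y Z"
    using l[THEN linear_scale] by auto
  show "b 0 Y Z = 0" "b X 0 Z = 0" "b X Y 0 = 0"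
    using l[THEN linear_0] by auto
  show "b (X - X') Y Z = b X Y Z - b X' Y Z" "b X (Y - Y') Z = b X Y Z - b X Y' Z"
    "b X Y (Z - Z') = b X Y Z - b X Y Z'"
    using l[THEN linear_diff] by auto
qed

lemma trilinear_combine:
  assumes "trilinear b" "trilinear c"
  shows "trilinear (\<lambda>X Y Z. s * b X Y Z + t * c X Y Z)"
  unfolding trilinear_iff
  by (intro conjI allI linearI)
    (auto simp: trilinear_add assms trilinear_scaleR algebra_simps)

lemma trilinear_compose:
  assumes "trilinear b" "linear f" "linear g" "linear k"
  shows "trilinear (\<lambda>X Y Z. b (f X) (g Y) (k Z))"
proof -
  note l = assms(2-4)[THEN linear_add] assms(2-4)[THEN linear_scale]
    trilinear_add[OF assms(1)] trilinear_scaleR[OF assms(1)]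
  show ?thesis
    unfolding trilinear_iff by (intro conjI allI linearI) (auto simp: l)
qed

lemma linear_identity: "linear (\<lambda>x::'a::real_vector. x)"
  by (intro linearI) auto

section \<open>Inner products\<close>

locale inner_form =
  fixes h :: "'e::euclidean_space \<Rightarrow> 'e \<Rightarrow> real"
  assumes bilinear_h: "bilinear h"
    and h_sym: "h x y = h y x"
    and h_pos: "x \<noteq> 0 \<Longrightarrow> 0 < h x x"
begin

lemmas h_simps = bilinear_ladd[OF bilinear_h] bilinear_radd[OF bilinear_h]
  bilinear_lneg[OF bilinear_h] bilinear_rneg[OF bilinear_h]
  bilinear_lsub[OF bilinear_h] bilinear_rsub[OF bilinear_h]
  bilinear_lmul[OF bilinear_h] bilinear_rmul[OF bilinear_h]
  bilinear_lzero[OF bilinear_h] bilinear_rzero[OF bilinear_h]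

lemma linear_h: "linear (h x)" "linear (\<lambda>x. h x y)"
  using bilinear_h unfolding bilinear_def by auto

lemma h_eq_0_iff: "h x x = 0 \<longleftrightarrow> x = 0"
  using h_pos[of x] by (cases "x = 0") (auto simp: h_simps)

lemma normalize:
  assumes "x \<noteq> 0"
  obtains a where "a \<noteq> 0" "h (a *\<^sub>R x) (a *\<^sub>R x) = 1"
proof
  show "1 / sqrt (h x x) \<noteq> 0" using h_pos[OF assms] by simp
  show "h ((1 / sqrt (h x x)) *\<^sub>R x) ((1 / sqrt (h x x)) *\<^sub>R x) = 1"
    using h_pos[OF assms] by (simp add: h_simps)
qed

definition orthonormal :: "'e set \<Rightarrow> bool" where
  "orthonormal E \<longleftrightarrow> (\<forall>u\<in>E. \<forall>v\<in>E. h u v = (if u = v then 1 else 0))"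

lemma orthonormal_sum:
  assumes "orthonormal E" "finite E" "v \<in> E"
  shows "h (\<Sum>e\<in>E. f e *\<^sub>R e) v = f v"
proof -
  have "h (\<Sum>e\<in>E. f e *\<^sub>R e) v = (\<Sum>e\<in>E. f e * h e v)"
    using linear_sum[OF linear_h(2)[of v], of "\<lambda>e. f e *\<^sub>R e" E] by (simp add: h_simps)
  also have "\<dots> = (\<Sum>e\<in>E. if e = v then f e else 0)"
    using assms by (intro sum.cong) (auto simp: orthonormal_def)
  finally show ?thesis using assms by simp
qed

lemma orthonormal_independent:
  assumes "orthonormal E" "finite E"
  shows "independent E"
proof (rule independent_if_scalars_zero[OF assms(2)])
  fix f v assume "(\<Sum>x\<in>E. f x *\<^sub>R x) = 0" "v \<in> E"
  with orthonormal_sum[OF assms, of v f] show "f v = 0" by (simp add: h_simps)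
qed

text \<open>One Gram-Schmidt step: the component of \<open>z\<close> orthogonal to \<open>E\<close>
  is nonzero because \<open>z\<close> is outside the span, so it can be normalized.\<close>

lemma orthonormal_extend:
  assumes "orthonormal E" "finite E" "z \<notin> span E"
  obtains v where "\<forall>e\<in>E. h v e = 0" "h v v = 1"
proof -
  define y where "y = z - (\<Sum>e\<in>E. h z e *\<^sub>R e)"
  have "y \<noteq> 0"
  proof
    assume "y = 0"
    then have "z = (\<Sum>e\<in>E. h z e *\<^sub>R e)" by (simp add: y_def)
    also have "\<dots> \<in> span E" by (intro span_sum span_scale span_base)
    finally show False using assms(3) by simp
  qed
  then obtain a where a: "h (a *\<^sub>R y) (a *\<^sub>R y) = 1" by (rule normalize)
  have "\<forall>e\<in>E. h (a *\<^sub>R y) e = 0"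
    using orthonormal_sum[OF assms(1,2)] by (simp add: y_def h_simps)
  with a that show thesis by blast
qed

lemma orthonormal_basisI:
  assumes "orthonormal E" "finite E" "card E = DIM('e)"
  shows "orthonormal_basis h E"
proof -
  have "span E = UNIV"
    using orthonormal_independent[OF assms(1,2)] assms
    by (metis card_eq_dim dim_UNIV span_UNIV subset_UNIV top.extremum_unique)
  with assms show ?thesis by (auto simp: orthonormal_basis_def orthonormal_def)
qed

lemma ex_orthonormal_basis: "\<exists>E. orthonormal_basis h E"
proof -
  have "\<exists>E. orthonormal E \<and> finite E \<and> card E = n" if "n \<le> DIM('e)" for n
    using that
  proof (induction n)
    case 0
    show ?case by (rule exI[of _ "{}"]) (simp add: orthonormal_def)
  next
    case (Suc n)
    then obtain E where E: "orthonormal E" "finite E" "card E = n" by auto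
    have "span E \<noteq> UNIV"
      using Suc.prems E by (metis dim_UNIV dim_span dim_le_card not_less_eq_eq order_refl span_superset)
    then obtain z where "z \<notin> span E" by auto
    with E obtain v where v: "\<forall>e\<in>E. h v e = 0" "h v v = 1"
      by (metis orthonormal_extend)
    then have "v \<notin> E" by force
    then show ?case using E v h_sym
      by (intro exI[of _ "insert v E"]) (auto simp: orthonormal_def)
  qed
  then show ?thesis using orthonormal_basisI by blast
qed

lemma orthonormal_basis_expand:
  assumes "orthonormal_basis h E"
  shows "x = (\<Sum>e\<in>E. h x e *\<^sub>R e)"
proof (rule ccontr)
  define y where "y = x - (\<Sum>e\<in>E. h x e *\<^sub>R e)"
  have E: "orthonormal E" "finite E" "span E = UNIV"
    using assms by (auto simp: orthonormal_basis_def orthonormal_def)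
  assume "x \<noteq> (\<Sum>e\<in>E. h x e *\<^sub>R e)"
  then have "y \<noteq> 0" by (simp add: y_def)
  have "h y e = 0" if "e \<in> E" for e
    using orthonormal_sum[OF E(1,2) that] by (simp add: y_def h_simps)
  then have "h y z = 0" if "z \<in> span E" for z
    using that by (rule linear_eq_0_on_span[OF linear_h(1)]) auto
  then show False using h_eq_0_iff \<open>y \<noteq> 0\<close> E(3) by auto
qed

text \<open>The contraction rule behind \<open>sum_A\<close> and the traces of
  \<open>lee_form\<close>.\<close>

lemma orthonormal_basis_sum:
  assumes "orthonormal_basis h E" "linear f"
  shows "(\<Sum>e\<in>E. h e x * f e) = f x"
proof -
  have "f x = (\<Sum>e\<in>E. h x e *\<^sub>R f e)"
    using arg_cong[OF orthonormal_basis_expand[OF assms(1)], of f x]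
    by (simp add: linear_sum[OF assms(2)] linear_scale[OF assms(2)])
  then show ?thesis by (simp add: h_sym[of x])
qed

lemma orthonormal_basis_card:
  assumes "orthonormal_basis h E"
  shows "card E = DIM('e)"
  using assms orthonormal_independent[of E]
  by (metis dim_UNIV dim_eq_card dim_span orthonormal_basis_def orthonormal_def)

lemma sum_trace:
  assumes "orthonormal_basis h E"
  shows "(\<Sum>e\<in>E. h e e) = DIM('e)"
  using orthonormal_basis_card[OF assms] assms by (simp add: orthonormal_basis_def)

end

section \<open>Projections to the Gray-Hervella classes\<close>

text \<open>On tensors \<open>b\<close> as in \<^const>\<open>WW\<close>, \<open>b(X, Y, Z) + b(AX, AY, Z)\<close> and \<open>b(X, Y, Z) - b(AX, AY, Z)\<close> are twice
  the components in \<open>W3 + W4\<close> and in \<open>W1 + W2\<close>. The latter component has no part in \<open>W2\<close> if it is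
  totally skew, and none in \<open>W1\<close> if its cyclic sum vanishes.\<close>

definition vanishing_herm where
  "vanishing_herm A b \<longleftrightarrow> (\<forall>X Y Z. b X Y Z + b (A X) (A Y) Z = (0::real))"

definition vanishing_anti where
  "vanishing_anti A b \<longleftrightarrow> (\<forall>X Y Z. b X Y Z - b (A X) (A Y) Z = (0::real))"

definition skew_anti where
  "skew_anti A b \<longleftrightarrow>
     (\<forall>X Y Z. b X Y Z - b (A X) (A Y) Z + b Y X Z - b (A Y) (A X) Z = (0::real))"

definition cyclic_anti where
  "cyclic_anti A b \<longleftrightarrow>
     (\<forall>X Y Z. b X Y Z - b (A X) (A Y) Z + b Y Z X - b (A Y) (A Z) X + b Z X Y - b (A Z) (A X) Y
        = (0::real))"

text \<open>The tensor of type \<open>W4\<close> with one-form \<beta>.\<close>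

definition lee_form where
  "lee_form h A \<beta> X Y Z =
     h X Y * \<beta> Z - h X Z * \<beta> Y - h X (A Y) * \<beta> (A Z) + h X (A Z) * (\<beta> (A Y)::real)"

text \<open>For \<open>b\<close> in \<open>WW A\<close>: the component in \<open>W3 + W4\<close> has
  no part in \<open>W3\<close>. The factor 2 is there because the left-hand side is twice that
  component.\<close>

definition herm_lee where
  "herm_lee h A b \<longleftrightarrow> (\<exists>\<beta>. linear \<beta> \<and>
     (\<forall>X Y Z. b X Y Z + b (A X) (A Y) Z = 2 * lee_form h A \<beta> X Y Z))"

definition traceless where
  "traceless h b \<longleftrightarrow> (\<forall>E Z. orthonormal_basis h E \<longrightarrow> (\<Sum>e\<in>E. b e e Z) = 0)"

lemma vanishing_herm_add:
  assumes "vanishing_herm A b" "vanishing_herm A c"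
  shows "vanishing_herm A (\<lambda>X Y Z. b X Y Z + c X Y Z)"
  unfolding vanishing_herm_def
proof (intro allI)
  fix X Y Z
  show "b X Y Z + c X Y Z + (b (A X) (A Y) Z + c (A X) (A Y) Z) = 0"
    using assms[unfolded vanishing_herm_def, rule_format, of X Y Z] by linarith
qed

lemma vanishing_anti_add:
  "vanishing_anti A b \<Longrightarrow> vanishing_anti A c \<Longrightarrow> vanishing_anti A (\<lambda>X Y Z. b X Y Z + c X Y Z)"
  unfolding vanishing_anti_def by simp

lemma skew_anti_add:
  assumes "skew_anti A b" "skew_anti A c"
  shows "skew_anti A (\<lambda>X Y Z. b X Y Z + c X Y Z)"
  unfolding skew_anti_def
proof (intro allI)
  fix X Y Z
  show "b X Y Z + c X Y Z - (b (A X) (A Y) Z + c (A X) (A Y) Z) + (b Y X Z + c Y X Z)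
      - (b (A Y) (A X) Z + c (A Y) (A X) Z) = 0"
    using assms[unfolded skew_anti_def, rule_format, of X Y Z] by linarith
qed

lemma cyclic_anti_add:
  assumes "cyclic_anti A b" "cyclic_anti A c"
  shows "cyclic_anti A (\<lambda>X Y Z. b X Y Z + c X Y Z)"
  unfolding cyclic_anti_def
proof (intro allI)
  fix X Y Z
  show "b X Y Z + c X Y Z - (b (A X) (A Y) Z + c (A X) (A Y) Z)
      + (b Y Z X + c Y Z X) - (b (A Y) (A Z) X + c (A Y) (A Z) X)
      + (b Z X Y + c Z X Y) - (b (A Z) (A X) Y + c (A Z) (A X) Y) = 0"
    using assms[unfolded cyclic_anti_def, rule_format, of X Y Z] by linarith
qed

lemma herm_lee_add:
  assumes "herm_lee h A b" "herm_lee h A c"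
  shows "herm_lee h A (\<lambda>X Y Z. b X Y Z + c X Y Z)"
proof -
  obtain \<beta> \<gamma> where
    "linear \<beta>" "\<And>X Y Z. b X Y Z + b (A X) (A Y) Z = 2 * lee_form h A \<beta> X Y Z"
    "linear \<gamma>" "\<And>X Y Z. c X Y Z + c (A X) (A Y) Z = 2 * lee_form h A \<gamma> X Y Z"
    using assms unfolding herm_lee_def by blast
  moreover have "lee_form h A (\<lambda>x. \<beta> x + \<gamma> x) X Y Z = lee_form h A \<beta> X Y Z + lee_form h A \<gamma> X Y Z"
    for X Y Z
    by (simp add: lee_form_def algebra_simps)
  ultimately show ?thesis
    unfolding herm_lee_def
    by (intro exI[of _ "\<lambda>x. \<beta> x + \<gamma> x"]) (auto intro: linear_compose_add simp: algebra_simps)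
qed

lemma traceless_add:
  "traceless h b \<Longrightarrow> traceless h c \<Longrightarrow> traceless h (\<lambda>X Y Z. b X Y Z + c X Y Z)"
  unfolding traceless_def by (simp add: sum.distrib)

text \<open>Membership in a sum of classes is used only through necessary conditions closed under
  addition, so it suffices to check the summands.\<close>

lemma gray_hervella_sum_all:
  fixes U V :: "'e gray_hervella"
  assumes "\<And>b c. P b \<Longrightarrow> P c \<Longrightarrow> P (\<lambda>X Y Z. b X Y Z + c X Y Z)"
    and "\<forall>b\<in>U h A. P b" "\<forall>b\<in>V h A. P b"
  shows "\<forall>b\<in>(U + V) h A. P b"
  using assms unfolding Ball_def gray_hervella_sum by blast

locale hermitian_form = inner_form h for h :: "'e::euclidean_space \<Rightarrow> 'e \<Rightarrow> real" +
  fixes A :: "'e \<Rightarrow> 'e"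
  assumes linear_A: "linear A"
    and A_A: "A (A x) = - x"
    and h_A: "h (A x) (A y) = h x y"
begin

lemma h_A_left: "h (A x) y = - h x (A y)"
  using h_A[of x "A y"] by (simp add: A_A h_simps)

lemma WW_trilinear: "b \<in> WW A \<Longrightarrow> trilinear b"
  unfolding WW_def trilinear_def by blast

lemma WW_skew: "b \<in> WW A \<Longrightarrow> b X Z Y = - b X Y Z"
  unfolding WW_def by blast

lemma WW_A_A: "b \<in> WW A \<Longrightarrow> b X (A Y) (A Z) = - b X Y Z"
  unfolding WW_def by blast

lemma WW_A:
  assumes "b \<in> WW A"
  shows "b X (A Y) Z = b X Y (A Z)"
proof -
  have "b X (A Y) (A (A Z)) = - b X Y (A Z)" by (rule WW_A_A[OF assms])
  then show ?thesis by (simp add: A_A trilinear_minus[OF WW_trilinear[OF assms]])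
qed

text \<open>For a totally skew tensor, rotating the arguments carries the defining identity of
  \<open>WW\<close> from the last two arguments to the first two. Hence the component in
  \<open>W3 + W4\<close> vanishes, and \<beta> can be taken to be 0.\<close>

lemma W1:
  assumes "b \<in> W1 h A"
  shows "vanishing_herm A b" "skew_anti A b" "herm_lee h A b" "traceless h b"
proof -
  have b: "b \<in> WW A" "\<And>X Z. b X X Z = 0" using assms by (auto simp: W1_def)
  note t = WW_trilinear[OF b(1)]
  have skew: "b Y X Z = - b X Y Z" for X Y Z
    using b(2)[of "X + Y" Z] b(2)[of X Z] b(2)[of Y Z] by (simp add: trilinear_add[OF t])
  have A: "b (A X) (A Y) Z = - b X Y Z" for X Y Z
  proof -
    have "b (A X) (A Y) Z = b Z (A X) (A Y)"
      using skew[of "A X" Z "A Y"] WW_skew[OF b(1), of "A X" Z "A Y"] by simp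
    also have "\<dots> = - b Z X Y" by (rule WW_A_A) (rule b)
    also have "\<dots> = - b X Y Z"
      using skew[of X Z Y] WW_skew[OF b(1), of X Z Y] by simp
    finally show ?thesis .
  qed
  show "vanishing_herm A b" "traceless h b"
    using b(2) by (auto simp: vanishing_herm_def traceless_def A)
  show "skew_anti A b"
    unfolding skew_anti_def
  proof (intro allI)
    fix X Y Z
    show "b X Y Z - b (A X) (A Y) Z + b Y X Z - b (A Y) (A X) Z = 0"
      using skew[of X Y Z] A[of X Y Z] A[of Y X Z] by simp
  qed
  show "herm_lee h A b"
    unfolding herm_lee_def
    by (rule exI[of _ "\<lambda>_. 0"]) (simp add: A lee_form_def linear_zero)
qed

text \<open>Traces do not change because \<open>A\<close> is an isometry. Instead of passing to the
  basis of the vectors \<open>A e\<close>, the proof expands one argument in \<open>E\<close> and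
  uses that \<open>A\<close> is skew.\<close>

lemma sum_A:
  assumes E: "orthonormal_basis h E" and B: "bilinear B"
  shows "(\<Sum>e\<in>E. B (A e) (A e)) = (\<Sum>e\<in>E. B e e :: real)"
proof -
  have l: "linear (\<lambda>x. B x y)" "linear (B x)" for x y
    using B by (auto simp: bilinear_def)
  have "(\<Sum>e\<in>E. B (A e) (A e)) = (\<Sum>e\<in>E. \<Sum>f\<in>E. h f (A e) * B f (A e))"
    by (intro sum.cong refl orthonormal_basis_sum[OF E l(1), symmetric])
  also have "\<dots> = (\<Sum>f\<in>E. \<Sum>e\<in>E. h f (A e) * B f (A e))"
    by (rule sum.swap)
  also have "\<dots> = (\<Sum>f\<in>E. - (\<Sum>e\<in>E. h e (A f) * B f (A e)))"
  proof -
    have "h f (A e) = - h e (A f)" for e f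
      using h_sym[of f "A e"] h_A_left[of e f] by linarith
    then show ?thesis unfolding sum_negf[symmetric] by (intro sum.cong refl) (metis mult_minus_left)
  qed
  also have "\<dots> = (\<Sum>f\<in>E. B f f)"
  proof (intro sum.cong refl)
    fix f
    have "linear (\<lambda>x. B f (A x))"
      using linear_compose[OF linear_A l(2)] by (simp add: o_def)
    from orthonormal_basis_sum[OF E this, of "A f"]
    show "- (\<Sum>e\<in>E. h e (A f) * B f (A e)) = B f f"
      by (simp add: A_A bilinear_rneg[OF B])
  qed
  finally show ?thesis .
qed

text \<open>The cyclic identity kills the component in \<open>W3 + W4\<close>. The trace then
  vanishes, since applying \<open>A\<close> to the first two arguments reverses the sign of
  \<open>b\<close> but preserves the trace.\<close>

lemma W2:
  assumes "b \<in> W2 h A"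
  shows "vanishing_herm A b" "cyclic_anti A b" "herm_lee h A b" "traceless h b"
proof -
  have b: "b \<in> WW A" and cyc: "\<And>X Y Z. b X Y Z + b Y Z X + b Z X Y = 0"
    using assms by (auto simp: W2_def)
  note t = WW_trilinear[OF b]
  \<comment> \<open>Twice the component in \<open>W3 + W4\<close>. It changes sign when its
    arguments are rotated, so three rotations give \<open>c = - c\<close>.\<close>
  define c where "c X Y Z = b X Y Z + b (A X) (A Y) Z" for X Y Z
  have c: "c X Y Z = - c Y Z X" for X Y Z
  proof -
    have "b Z (A X) (A Y) = - b Z X Y" by (rule WW_A_A) (rule b)
    then show ?thesis
      using cyc[of X Y Z] cyc[of "A X" "A Y" Z] WW_A[OF b, of "A Y" Z X] by (simp add: c_def)
  qed
  have c0: "c X Y Z = 0" for X Y Z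
    using c[of X Y Z] c[of Y Z X] c[of Z X Y] by simp
  then have A: "b (A X) (A Y) Z = - b X Y Z" for X Y Z
    unfolding c_def by (smt (verit))
  show "vanishing_herm A b" using A by (simp add: vanishing_herm_def)
  show "cyclic_anti A b"
    unfolding cyclic_anti_def
  proof (intro allI)
    fix X Y Z
    show "b X Y Z - b (A X) (A Y) Z + b Y Z X - b (A Y) (A Z) X + b Z X Y - b (A Z) (A X) Y = 0"
      using A[of X Y Z] A[of Y Z X] A[of Z X Y] cyc[of X Y Z] by simp
  qed
  show "herm_lee h A b"
    unfolding herm_lee_def
    by (rule exI[of _ "\<lambda>_. 0"]) (simp add: A lee_form_def linear_zero)
  show "traceless h b"
    unfolding traceless_def
  proof (intro allI impI)
    fix E Z
    assume E: "orthonormal_basis h E"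
    have "bilinear (\<lambda>X Y. b X Y Z)"
      using t by (auto simp: trilinear_iff bilinear_def)
    from sum_A[OF E this] show "(\<Sum>e\<in>E. b e e Z) = 0"
      by (simp add: A sum_negf)
  qed
qed

lemma W3:
  assumes "b \<in> W3 h A"
  shows "vanishing_anti A b" "skew_anti A b" "cyclic_anti A b" "traceless h b"
  using assms
  by (auto simp: W3_def vanishing_anti_def skew_anti_def cyclic_anti_def traceless_def)

lemma W4:
  assumes "b \<in> W4 h A"
  shows "vanishing_anti A b" "skew_anti A b" "cyclic_anti A b" "herm_lee h A b"
proof -
  obtain \<beta> where \<beta>: "linear \<beta>" and b: "\<And>X Y Z. b X Y Z = lee_form h A \<beta> X Y Z"
    using assms unfolding W4_def lee_form_def by blast
  have A: "b (A X) (A Y) Z = b X Y Z" for X Y Z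
    by (simp add: b lee_form_def h_A A_A h_simps linear_neg[OF \<beta>] h_A_left)
  then show "vanishing_anti A b" "skew_anti A b" "cyclic_anti A b"
    by (auto simp: vanishing_anti_def skew_anti_def cyclic_anti_def)
  show "herm_lee h A b"
    unfolding herm_lee_def using \<beta> A b by (intro exI[of _ \<beta>]) simp
qed

text \<open>The digits follow the order of the summands in the conditions of the theorem:
  \<open>C + W3\<close> leads to \<open>W143_skew\<close>, while \<open>W1 + W3 + W4\<close> needs
  \<open>W134_skew\<close>.\<close>

lemma
  shows W12_herm: "\<forall>b\<in>(W1 + W2) h A. vanishing_herm A b"
    and W14_skew: "\<forall>b\<in>(W1 + W4) h A. skew_anti A b"
    and W14_lee: "\<forall>b\<in>(W1 + W4) h A. herm_lee h A b"
    and W24_cyclic: "\<forall>b\<in>(W2 + W4) h A. cyclic_anti A b"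
    and W24_lee: "\<forall>b\<in>(W2 + W4) h A. herm_lee h A b"
    and W34_anti: "\<forall>b\<in>(W3 + W4) h A. vanishing_anti A b"
    and W124_lee: "\<forall>b\<in>(W1 + W2 + W4) h A. herm_lee h A b"
    and W123_traceless: "\<forall>b\<in>(W1 + W2 + W3) h A. traceless h b"
    and W143_skew: "\<forall>b\<in>(W1 + W4 + W3) h A. skew_anti A b"
    and W134_skew: "\<forall>b\<in>(W1 + W3 + W4) h A. skew_anti A b"
    and W243_cyclic: "\<forall>b\<in>(W2 + W4 + W3) h A. cyclic_anti A b"
    and W234_cyclic: "\<forall>b\<in>(W2 + W3 + W4) h A. cyclic_anti A b"
    and W13_skew: "\<forall>b\<in>(W1 + W3) h A. skew_anti A b"
    and W13_traceless: "\<forall>b\<in>(W1 + W3) h A. traceless h b"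
  by ((rule gray_hervella_sum_all)+,
      (erule (1) vanishing_herm_add vanishing_anti_add skew_anti_add cyclic_anti_add herm_lee_add
        traceless_add | (rule ballI, erule W1 W2 W3 W4))+)+

end

section \<open>Quaternionic inner product spaces\<close>

text \<open>\<open>K\<close> is a parameter, so that the locale can be instantiated again with a
  cyclic permutation of the structures, or with \<open>J\<close>, \<open>I\<close> and
  \<open>- K\<close>.\<close>

locale quaternion_form = inner_form h for h :: "'e::euclidean_space \<Rightarrow> 'e \<Rightarrow> real" +
  fixes I J K :: "'e \<Rightarrow> 'e"
  assumes linear_I: "linear I" and linear_J: "linear J"
    and I_I: "I (I x) = - x" and J_J: "J (J x) = - x"
    and I_J: "I (J x) = K x" and J_I: "J (I x) = - K x"
    and h_I: "h (I x) (I y) = h x y" and h_J: "h (J x) (J y) = h x y"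
begin

lemma linear_K: "linear K"
proof -
  have "K = I \<circ> J" by (auto simp: I_J)
  then show ?thesis using linear_compose[OF linear_J linear_I] by simp
qed

lemmas neg = linear_neg[OF linear_I] linear_neg[OF linear_J] linear_neg[OF linear_K]

lemma I_K: "I (K x) = - J x"
  by (simp flip: I_J add: I_I)

lemma K_J: "K (J x) = - I x"
  by (simp flip: I_J add: J_J neg)

lemma J_K: "J (K x) = I x"
proof -
  have "J (K x) = - J (J (I x))" by (simp add: J_I neg)
  then show ?thesis by (simp add: J_J)
qed

lemma K_I: "K (I x) = J x"
proof -
  have "K (I x) = I (J (I x))" by (simp only: I_J)
  also have "\<dots> = - I (K x)" by (simp only: J_I neg)
  finally show ?thesis by (simp add: I_K)
qed

lemma K_K: "K (K x) = - x"
proof -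
  have "K (K x) = I (J (K x))" by (simp only: I_J)
  then show ?thesis by (simp add: J_K I_I)
qed

lemmas quat = I_I J_J K_K I_J J_I J_K K_J K_I I_K neg

lemma h_K: "h (K x) (K y) = h x y"
  by (simp flip: I_J add: h_I h_J)

sublocale I: hermitian_form h I
  by (intro hermitian_form.intro inner_form_axioms hermitian_form_axioms.intro)
    (simp_all add: linear_I quat h_I)

sublocale J: hermitian_form h J
  by (intro hermitian_form.intro inner_form_axioms hermitian_form_axioms.intro)
    (simp_all add: linear_J quat h_J)

sublocale K: hermitian_form h K
  by (intro hermitian_form.intro inner_form_axioms hermitian_form_axioms.intro)
    (simp_all add: linear_K quat h_K)

lemma cyclic: "quaternion_form h J K I"
  by (intro quaternion_form.intro inner_form_axioms quaternion_form_axioms.intro)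
    (simp_all add: linear_J linear_K quat h_J h_K)

lemma swap: "quaternion_form h J I (\<lambda>x. - K x)"
  by (intro quaternion_form.intro inner_form_axioms quaternion_form_axioms.intro)
    (simp_all add: linear_I linear_J quat h_J h_I)

lemmas hq = I.h_A_left J.h_A_left K.h_A_left h_simps

lemma h_left_0 [simp]: "h x (I x) = 0" "h x (J x) = 0" "h x (K x) = 0"
  using h_sym[of x "I x"] h_sym[of x "J x"] h_sym[of x "K x"] by (auto simp: hq)

text \<open>Orthogonality of the quaternionic lines of \<open>x\<close> and \<open>y\<close>, as
  \<open>I\<close>, \<open>J\<close>, \<open>K\<close> are skew isometries.\<close>

definition qorth :: "'e \<Rightarrow> 'e \<Rightarrow> bool" where
  "qorth x y \<longleftrightarrow> h x y = 0 \<and> h x (I y) = 0 \<and> h x (J y) = 0 \<and> h x (K y) = 0"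

lemma qorth_sym: "qorth x y \<Longrightarrow> qorth y x"
  using h_sym[of x y] h_sym[of x "I y"] h_sym[of x "J y"] h_sym[of x "K y"]
  by (auto simp: qorth_def hq)

definition qline :: "'e \<Rightarrow> 'e set" where
  "qline x = {x, I x, J x, K x}"

lemma unit_ne:
  assumes "h x x = 1"
  shows "x \<noteq> I x" "x \<noteq> J x" "x \<noteq> K x" "I x \<noteq> J x" "I x \<noteq> K x" "J x \<noteq> K x"
proof -
  have "h (I x) (J x) = 0" "h (I x) (K x) = 0" "h (J x) (K x) = 0" by (simp_all add: hq quat)
  then show "x \<noteq> I x" "x \<noteq> J x" "x \<noteq> K x" "I x \<noteq> J x" "I x \<noteq> K x" "J x \<noteq> K x"
    using assms h_left_0[of x] h_I[of x x] h_J[of x x] by (metis zero_neq_one)+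
qed

lemma orthonormal_qline:
  assumes "h x x = 1"
  shows "orthonormal (qline x)"
  using assms unit_ne[OF assms] unfolding orthonormal_def qline_def by (auto simp: hq quat)

lemma sum_qline:
  assumes "h x x = 1"
  shows "(\<Sum>e\<in>qline x. f e) = f x + f (I x) + f (J x) + (f (K x) :: real)"
  using unit_ne[OF assms] by (simp add: qline_def add.assoc)

lemma ex_qorth_unit:
  assumes "4 < DIM('e)" "h x x = 1"
  obtains y where "h y y = 1" "qorth y x"
proof -
  have fin: "finite (qline x)" by (simp add: qline_def)
  have "card (qline x) \<le> 4"
    by (simp add: qline_def card_insert_if)
  then have "span (qline x) \<noteq> UNIV"
    using assms(1) fin by (metis dim_UNIV dim_span dim_le_card linorder_not_less order_trans span_superset)
  then obtain z where "z \<notin> span (qline x)" by auto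
  from orthonormal_extend[OF orthonormal_qline[OF assms(2)] fin this] that show thesis
    by (auto simp: qline_def qorth_def)
qed

text \<open>A quaternionic line has dimension at most four, so it leaves room for a unit vector
  orthogonal to it. The case \<open>x = 0\<close> is included because the lemma is applied to
  arbitrary arguments of a one-form.\<close>

lemma ex_qorth:
  assumes "4 < DIM('e)"
  obtains y where "h y y = 1" "qorth y x"
proof (cases "x = 0")
  case True
  obtain y :: 'e where "y \<noteq> 0" using nonempty_Basis nonzero_Basis by blast
  then obtain a where "h (a *\<^sub>R y) (a *\<^sub>R y) = 1" by (rule normalize)
  from that[OF this] True show thesis
    by (auto simp: qorth_def h_simps linear_0[OF linear_I] linear_0[OF linear_J] linear_0[OF linear_K])
next
  case False
  then obtain a where a: "a \<noteq> 0" "h (a *\<^sub>R x) (a *\<^sub>R x) = 1" by (rule normalize)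
  with ex_qorth_unit[OF assms a(2)] obtain y where "h y y = 1" "qorth y (a *\<^sub>R x)" by blast
  with a that show thesis
    by (auto simp: qorth_def h_simps linear_scale[OF linear_I] linear_scale[OF linear_J]
        linear_scale[OF linear_K])
qed

text \<open>In dimension eight two orthogonal quaternionic lines fill the space.\<close>

lemma sum_dim8:
  assumes "DIM('e) = 8" "h x x = 1" "h y y = 1" "qorth x y"
  obtains E where "orthonormal_basis h E"
    "\<And>f. (\<Sum>e\<in>E. f e) = (\<Sum>e\<in>qline x. f e) + (\<Sum>e\<in>qline y. f e :: real)"
proof -
  have orth: "h u v = 0" if "u \<in> qline x" "v \<in> qline y" for u v
    using that assms(4) by (auto simp: qline_def qorth_def hq quat)
  have unit: "h u u = 1" if "u \<in> qline x" for u
    using that assms(2) by (auto simp: qline_def hq quat)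
  have disj: "qline x \<inter> qline y = {}"
    using orth unit by fastforce
  have fin: "finite (qline u)" for u by (simp add: qline_def)
  have card: "card (qline u) = 4" if "h u u = 1" for u
    using unit_ne[OF that] by (simp add: qline_def)
  have "orthonormal (qline x \<union> qline y)"
    using orthonormal_qline[OF assms(2)] orthonormal_qline[OF assms(3)] orth disj
    unfolding orthonormal_def by (auto simp: h_sym dest: orth)
  moreover have "card (qline x \<union> qline y) = 8"
    using disj fin card assms by (simp add: card_Un_disjoint)
  ultimately have "orthonormal_basis h (qline x \<union> qline y)"
    using assms fin by (intro orthonormal_basisI) auto
  moreover have "(\<Sum>e\<in>qline x \<union> qline y. f e) = (\<Sum>e\<in>qline x. f e) + (\<Sum>e\<in>qline y. f e :: real)" for f
    using disj fin by (simp add: sum.union_disjoint)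
  ultimately show thesis using that by blast
qed

text \<open>The vanishing contraction gives \<open>b x (J x) y = 0\<close> for all \<open>x\<close> and \<open>y\<close>, so that \<open>J\<close> as well as
  \<open>I\<close> may be moved between the arguments of \<open>b\<close>, which contradicts \<open>I J = - J I\<close> unless \<open>b = 0\<close>.\<close>

lemma skew_form_dim8_eq_0:
  assumes dim: "DIM('e) = 8" and b: "trilinear b"
    and skew: "\<And>X Y Z. b X Y Z = - b Y X Z" "\<And>X Y Z. b X Z Y = - b X Y Z"
    and I: "\<And>X Y Z. b X (I Y) Z = b X Y (I Z)"
    and trace: "\<And>E Z. orthonormal_basis h E \<Longrightarrow> (\<Sum>e\<in>E. b e (J e) Z) = 0"
  shows "b X Y Z = 0"
proof -
  note t = trilinear_minus[OF b] trilinear_add[OF b] trilinear_scaleR[OF b]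
  have same: "b X X Z = 0" "b X Y X = 0" "b X Y Y = 0" for X Y Z
    using skew(1)[of X X Z] skew(1)[of X Y X] skew(2)[of Y X X] skew(2)[of X Y Y] by auto
  have I': "b (I X) Y Z = b X (I Y) Z" for X Y Z
    using skew(1)[of "I X" Y Z] I[of Y X Z] skew(1)[of Y X "I Z"] I[of X Y Z] by simp
  have line: "b x (J x) x' = 0" if "x' \<in> qline x" for x x'
  proof -
    have "b x (J x) (I x) = 0" using I[of x "J x" x] same by (simp add: quat)
    moreover have "b x (J x) (K x) = 0"
      using I[of x "J x" "J x"] skew(2)[of x "K x" "J x"] by (simp add: quat)
    ultimately show ?thesis using that same by (auto simp: qline_def)
  qed
  have orth: "b x (J x) y = 0" if "h x x = 1" "h y y = 1" "qorth x y" for x y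
  proof -
    obtain E where E: "orthonormal_basis h E"
      and sum: "\<And>f. (\<Sum>e\<in>E. f e) = (\<Sum>e\<in>qline x. f e) + (\<Sum>e\<in>qline y. f e :: real)"
      using sum_dim8[OF dim \<open>h x x = 1\<close> \<open>h y y = 1\<close> \<open>qorth x y\<close>] by blast
    \<comment> \<open>The four vectors of a quaternionic line contribute equally to the contraction.
      Taken at \<open>y\<close>, the contribution of the line of \<open>y\<close> vanishes by
      skewness, which leaves \<open>b x (J x) y\<close>.\<close>
    have four: "b x (J x) z + b (I x) (J (I x)) z + b (J x) (J (J x)) z + b (K x) (J (K x)) z
        = 4 * b x (J x) z" for x z
    proof -
      have "b (I x) (K x) z = - b x (J x) z"
        using I'[of x "K x" z] by (simp add: quat t)
      moreover have "b (J x) x z = - b x (J x) z" by (rule skew(1))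
      moreover have "b (K x) (I x) z = b x (J x) z"
        using calculation skew(1)[of "K x" "I x" z] by simp
      ultimately show ?thesis by (simp add: quat t)
    qed
    have "4 * b x (J x) y + 4 * b y (J y) y = 0"
      using trace[OF E, of y] unfolding sum sum_qline[OF that(1)] sum_qline[OF that(2)] four .
    then show ?thesis using same by simp
  qed
  have "b x (J x) y = 0" for x y
  proof -
    have unit: "b x (J x) y = 0" if x: "h x x = 1" for x y
    proof -
      have fin: "finite (qline x)" by (simp add: qline_def)
      define w where "w = y - (\<Sum>e\<in>qline x. h y e *\<^sub>R e)"
      have "h w e = 0" if "e \<in> qline x" for e
        using orthonormal_sum[OF orthonormal_qline[OF x] fin that] by (simp add: w_def h_simps)
      then have "qorth w x" by (simp add: qline_def qorth_def)
      then have w: "qorth x w" by (rule qorth_sym)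
      have "b x (J x) w = 0"
      proof (cases "w = 0")
        case True
        then show ?thesis by (simp add: trilinear_zero[OF b])
      next
        case False
        then obtain a where a: "a \<noteq> 0" "h (a *\<^sub>R w) (a *\<^sub>R w) = 1" by (rule normalize)
        moreover have "qorth x (a *\<^sub>R w)"
          using w by (simp add: qorth_def h_simps linear_scale[OF linear_I] linear_scale[OF linear_J]
              linear_scale[OF linear_K])
        ultimately have "b x (J x) (a *\<^sub>R w) = 0" using orth x by blast
        then show ?thesis using a by (simp add: t)
      qed
      moreover have "linear (b x (J x))" using b by (simp add: trilinear_iff)
      then have "b x (J x) (\<Sum>e\<in>qline x. h y e *\<^sub>R e) = (\<Sum>e\<in>qline x. h y e * b x (J x) e)"
        by (simp add: linear_sum t)
      then have "b x (J x) (\<Sum>e\<in>qline x. h y e *\<^sub>R e) = 0" by (simp add: line)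
      ultimately show ?thesis by (simp add: w_def trilinear_diff[OF b])
    qed
    show ?thesis
    proof (cases "x = 0")
      case True
      then show ?thesis by (simp add: trilinear_zero[OF b])
    next
      case False
      then obtain a where a: "a \<noteq> 0" "h (a *\<^sub>R x) (a *\<^sub>R x) = 1" by (rule normalize)
      then have "b (a *\<^sub>R x) (J (a *\<^sub>R x)) y = 0" using unit by blast
      then show ?thesis using a by (simp add: t linear_scale[OF linear_J])
    qed
  qed
  note J0 = this
  \<comment> \<open>Polarization of \<open>J0\<close>.\<close>
  have J: "b (J X) Y Z = b X (J Y) Z" for X Y Z
  proof -
    have "b X (J Y) Z + b Y (J X) Z = 0"
      using J0[of "X + Y" Z] J0[of X Z] J0[of Y Z] by (simp add: t linear_add[OF linear_J])
    then show ?thesis using skew(1)[of Y "J X" Z] by simp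
  qed
  have J': "b X (J Y) Z = b X Y (J Z)" for X Y Z
    using J[of Y X Z] J[of Z X Y] skew J[of X Y Z] J[of X Z Y] by (metis minus_minus)
  \<comment> \<open>Carrying \<open>I\<close> and \<open>J\<close> from the first argument to the
    last in the two possible orders gives \<open>J I\<close> here and \<open>I J\<close>
    below.\<close>
  have "b (K X) Y Z = b X Y (J (I Z))" for X Y Z
    using I'[of "J X" Y Z] I[of "J X" Y Z] J[of X Y "I Z"] J'[of X Y "I Z"] by (simp add: quat)
  moreover have "b (K X) Y Z = b X Y (I (J Z))" for X Y Z
    using I'[of "J X" Y Z] J[of X "I Y" Z] J'[of X "I Y" Z] I[of X Y "J Z"] by (simp add: quat)
  ultimately have "b X Y (K Z) = - b X Y (K Z)" for X Y Z
    by (metis I_J J_I t(3))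
  then have "b X Y (K Z) = 0" for X Y Z
    by (simp only: equal_neg_zero)
  from this[of X Y "K Z"] show ?thesis by (simp add: quat t)
qed

end

section \<open>The torsion at a point\<close>

context quaternion_form
begin

text \<open>If \<open>S X Y Z\<close> is written as \<open>h Y (s Z)\<close> with an endomorphism
  \<open>s\<close> depending on \<open>X\<close>, the conditions say that \<open>s\<close> is
  symmetric and commutes with \<open>I\<close> and \<open>J\<close>, hence with
  \<open>K\<close>.\<close>

definition qsym :: "('e \<Rightarrow> 'e \<Rightarrow> 'e \<Rightarrow> real) \<Rightarrow> bool" where
  "qsym S \<longleftrightarrow> trilinear S \<and> (\<forall>X Y Z. S X Z Y = S X Y Z) \<and>
     (\<forall>X Y Z. S X (I Y) Z = - S X Y (I Z)) \<and> (\<forall>X Y Z. S X (J Y) Z = - S X Y (J Z))"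

lemma qsym_move:
  assumes "qsym S"
  shows "S X (I Y) Z = - S X Y (I Z)" "S X (J Y) Z = - S X Y (J Z)" "S X (K Y) Z = - S X Y (K Z)"
proof -
  show *: "S X (I Y) Z = - S X Y (I Z)" "S X (J Y) Z = - S X Y (J Z)" for X Y Z
    using assms unfolding qsym_def by blast+
  have "trilinear S" using assms unfolding qsym_def by blast
  moreover have "S X (I (J Y)) Z = S X Y (J (I Z))"
    by (simp only: * minus_minus)
  ultimately show "S X (K Y) Z = - S X Y (K Z)"
    by (simp add: quat trilinear_minus)
qed

lemma qsym_swap: "qsym S \<Longrightarrow> S X Z Y = S X Y Z"
  unfolding qsym_def by blast

lemma qsym_trilinear: "qsym S \<Longrightarrow> trilinear S"
  unfolding qsym_def by blast

end

text \<open>The tensors \<open>p\<close>, \<open>q\<close>, \<open>r\<close> stand for \<open>\<nabla>\<omega>\<^sub>I\<close>, \<open>\<nabla>\<omega>\<^sub>J\<close>, \<open>\<nabla>\<omega>\<^sub>K\<close> at a point. They are encoded by three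
  one-forms \<open>S\<close>, \<open>T\<close>, \<open>U\<close> with values in the symmetric endomorphisms that commute with
  \<open>I\<close>, \<open>J\<close> and \<open>K\<close>.\<close>

locale torsion_form = quaternion_form h I J K
  for h :: "'e::euclidean_space \<Rightarrow> 'e \<Rightarrow> real" and I J K +
  fixes p q r S T U :: "'e \<Rightarrow> 'e \<Rightarrow> 'e \<Rightarrow> real"
  assumes S: "qsym S" and T: "qsym T" and U: "qsym U"
    and p_eq: "p X Y Z = U X Y (J Z) - T X Y (K Z)"
    and q_eq: "q X Y Z = S X Y (K Z) - U X Y (I Z)"
    and r_eq: "r X Y Z = T X Y (I Z) - S X Y (J Z)"
begin

text \<open>Shifting \<open>p\<close>, \<open>q\<close>, \<open>r\<close> shifts \<open>S\<close>,
  \<open>T\<close>, \<open>U\<close> as well, so each fact about \<open>p\<close> has versions for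
  \<open>q\<close> and \<open>r\<close>.\<close>

lemma cyclic_torsion: "torsion_form h J K I q r p T U S"
proof -
  interpret c: quaternion_form h J K I by (rule cyclic)
  have "c.qsym R" if "qsym R" for R
    using that qsym_move(2,3)[OF that] unfolding qsym_def c.qsym_def by blast
  then show ?thesis
    by (intro torsion_form.intro cyclic torsion_form_axioms.intro)
      (auto simp: S T U p_eq q_eq r_eq)
qed

lemmas moves = qsym_move[OF S] qsym_move[OF T] qsym_move[OF U]
  trilinear_minus[OF qsym_trilinear[OF S]] trilinear_minus[OF qsym_trilinear[OF T]]
  trilinear_minus[OF qsym_trilinear[OF U]]

lemmas eqs = p_eq q_eq r_eq moves quat

text \<open>The two summands of \<open>p\<close> react with different signs when \<open>K\<close> is
  moved between the last two arguments. So \<open>p\<close> determines \<open>T\<close>, and in the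
  same way \<open>U\<close>.\<close>

lemma T_of_p: "T X Y Z = (p X Y (K Z) - p X (K Y) Z) / 2"
  by (simp add: eqs)

lemma U_of_p: "U X Y Z = (p X (J Y) Z - p X Y (J Z)) / 2"
  by (simp add: eqs)

lemma U_of_q: "U X Y Z = (q X Y (I Z) - q X (I Y) Z) / 2"
  by (simp add: eqs)

lemma S_of_q: "S X Y Z = (q X (K Y) Z - q X Y (K Z)) / 2"
  by (simp add: eqs)

lemma p_0: "(\<And>X Y Z. p X Y Z = 0) \<Longrightarrow> T X Y Z = 0" "(\<And>X Y Z. p X Y Z = 0) \<Longrightarrow> U X Y Z = 0"
  by (simp_all add: T_of_p U_of_p)

lemma q_0: "(\<And>X Y Z. q X Y Z = 0) \<Longrightarrow> S X Y Z = 0" "(\<And>X Y Z. q X Y Z = 0) \<Longrightarrow> U X Y Z = 0"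
  by (simp_all add: S_of_q U_of_q)

lemma p_swap: "p X Z Y = - p X Y Z"
  using qsym_swap[OF T, of X Z "K Y"] qsym_swap[OF U, of X Z "J Y"] by (simp add: eqs)

lemma p_trilinear: "trilinear p"
proof -
  have "trilinear (\<lambda>X Y Z. 1 * U X Y (J Z) + (- 1) * T X Y (K Z))"
    by (intro trilinear_combine qsym_trilinear U T linear_J linear_K linear_identity
        trilinear_compose[of U "\<lambda>x. x" "\<lambda>x. x" J] trilinear_compose[of T "\<lambda>x. x" "\<lambda>x. x" K])
  moreover have "p = (\<lambda>X Y Z. 1 * U X Y (J Z) + (- 1) * T X Y (K Z))"
    by (auto simp: p_eq fun_eq_iff)
  ultimately show ?thesis by simp
qed

text \<open>The hypothesis has a \<open>J\<close> part and a \<open>K\<close> part, which the two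
  instances separate as in \<open>U_of_p\<close>.\<close>

lemma U_herm:
  assumes "vanishing_herm I p"
  shows "U X Y Z = T (I X) Y Z"
  using assms[unfolded vanishing_herm_def, rule_format, of X Y "J Z"]
    assms[unfolded vanishing_herm_def, rule_format, of X "J Y" Z]
  by (simp add: eqs)

lemma U_anti:
  assumes "vanishing_anti I p"
  shows "U X Y Z = - T (I X) Y Z"
  using assms[unfolded vanishing_anti_def, rule_format, of X Y "J Z"]
    assms[unfolded vanishing_anti_def, rule_format, of X "J Y" Z]
  by (simp add: eqs)

text \<open>By cyclic shifts: \<open>S_herm\<close> gives \<open>S = U \<circ> J\<close>, and
  \<open>T_herm\<close> gives \<open>T = S \<circ> K\<close>.\<close>

lemmas S_herm = torsion_form.U_herm[OF cyclic_torsion]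
lemmas S_anti = torsion_form.U_anti[OF cyclic_torsion]
lemmas T_herm = torsion_form.U_herm[OF torsion_form.cyclic_torsion[OF cyclic_torsion]]
lemmas q_swap = torsion_form.p_swap[OF cyclic_torsion]
lemmas q_trilinear = torsion_form.p_trilinear[OF cyclic_torsion]

section \<open>Criteria for flatness without one-forms of type \<open>W4\<close>\<close>

definition flat where
  "flat \<longleftrightarrow> (\<forall>X Y Z. p X Y Z = 0 \<and> q X Y Z = 0 \<and> r X Y Z = 0)"

lemma flatI:
  assumes "\<And>X Y Z. S X Y Z = 0" "\<And>X Y Z. T X Y Z = 0" "\<And>X Y Z. U X Y Z = 0"
  shows flat
  using assms by (simp add: flat_def p_eq q_eq r_eq)

lemma flat_p_S:
  assumes "\<And>X Y Z. p X Y Z = 0" "\<And>X Y Z. S X Y Z = 0"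
  shows flat
  using assms p_0 by (intro flatI) auto

text \<open>Going once around the cycle, \<open>T = S \<circ> K = U \<circ> J \<circ> K = U \<circ>
  I = T \<circ> I \<circ> I = - T\<close>.\<close>

lemma flat_of_hermitian:
  assumes "vanishing_herm I p" "vanishing_herm J q" "vanishing_herm K r"
  shows flat
proof -
  have "T X Y Z = 0" for X Y Z
    using T_herm[OF assms(3), of X Y Z] S_herm[OF assms(2), of "K X" Y Z]
      U_herm[OF assms(1), of "I X" Y Z]
    by (simp add: eqs)
  then show flat
    using S_herm[OF assms(2)] U_herm[OF assms(1)] by (intro flatI) auto
qed

lemma flat_p_herm:
  assumes "\<And>X Y Z. p X Y Z = 0" "vanishing_herm J q"
  shows flat
  using p_0[OF assms(1)] S_herm[OF assms(2)] by (intro flatI) auto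

lemma flat_p_anti:
  assumes "\<And>X Y Z. p X Y Z = 0" "vanishing_anti J q"
  shows flat
  using p_0[OF assms(1)] S_anti[OF assms(2)] by (intro flatI) auto

lemma flat_q_herm:
  assumes "\<And>X Y Z. q X Y Z = 0" "vanishing_herm I p"
  shows flat
proof -
  have "T X Y Z = 0" for X Y Z
    using U_herm[OF assms(2), of "I X" Y Z] q_0[OF assms(1)] by (simp add: eqs)
  then show flat using q_0[OF assms(1)] by (intro flatI) auto
qed

lemma flat_q_anti:
  assumes "\<And>X Y Z. q X Y Z = 0" "vanishing_anti I p"
  shows flat
proof -
  have "T X Y Z = 0" for X Y Z
    using U_anti[OF assms(2), of "I X" Y Z] q_0[OF assms(1)] by (simp add: eqs)
  then show flat using q_0[OF assms(1)] by (intro flatI) auto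
qed

lemma p_skew:
  assumes "vanishing_herm I p" "skew_anti I p"
  shows "p Y X Z = - p X Y Z"
  using assms(2)[unfolded skew_anti_def, rule_format, of X Y Z]
    assms(1)[unfolded vanishing_herm_def, rule_format, of X Y Z]
    assms(1)[unfolded vanishing_herm_def, rule_format, of Y X Z] by linarith

text \<open>If \<open>p\<close> is totally skew, then so is \<open>q\<close>.\<close>

lemma flat_W1_W2:
  assumes p: "vanishing_herm I p" "skew_anti I p"
    and q: "vanishing_herm J q" "cyclic_anti J q"
  shows flat
proof -
  have S': "S X Y Z = T (K X) Y Z" for X Y Z
    using S_herm[OF q(1)] U_herm[OF p(1)] by (simp add: I_J)
  \<comment> \<open>This expression treats the three arguments alike, so \<open>q\<close> inherits
    the skewness of \<open>p\<close>.\<close>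
  have q': "q X Y Z = - (p (K X) Y Z + p X (K Y) Z + p X Y (K Z) + p (K X) (K Y) (K Z)) / 2"
    for X Y Z
    by (simp add: eqs S' U_herm[OF p(1)])
  have skew: "q Y X Z = - q X Y Z" for X Y Z
    using p_skew[OF p, of "K X" Y Z] p_skew[OF p, of X "K Y" Z] p_skew[OF p, of X Y "K Z"]
      p_skew[OF p, of "K X" "K Y" "K Z"] by (simp add: q' field_simps)
  \<comment> \<open>For a totally skew tensor the cyclic sum is three times its value.\<close>
  have "q X Y Z = 0" for X Y Z
    using q(2)[unfolded cyclic_anti_def, rule_format, of X Y Z]
      q(1)[unfolded vanishing_herm_def, rule_format, of X Y Z]
      q(1)[unfolded vanishing_herm_def, rule_format, of Y Z X]
      q(1)[unfolded vanishing_herm_def, rule_format, of Z X Y]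
      skew[of Z Y X] q_swap[of Y Z X] q_swap[of Z X Y] q_swap[of X Y Z] skew[of X Z Y]
    by linarith
  then show flat using p(1) by (rule flat_q_herm)
qed

text \<open>Expressing \<open>q\<close> by the totally skew \<open>p\<close> gives
  \<open>q e e Z = - p e (K e) Z\<close>. So the trace condition on \<open>q\<close> is the
  vanishing contraction that \<open>skew_form_dim8_eq_0\<close> asks for.\<close>

lemma flat_W1_W3:
  assumes dim: "DIM('e) = 8"
    and p: "vanishing_herm I p" "skew_anti I p"
    and q: "vanishing_anti J q" "traceless h q"
  shows flat
proof -
  have S': "S X Y Z = - T (K X) Y Z" for X Y Z
    using S_anti[OF q(1)] U_herm[OF p(1)] by (simp add: I_J)
  have q': "q X Y Z = (p (K X) Y Z + p (K X) (K Y) (K Z) - p X Y (K Z) - p X (K Y) Z) / 2"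
    for X Y Z
    by (simp add: eqs S' U_herm[OF p(1)])
  have trace: "q e e Z = - p e (K e) Z" for e Z
    using p_skew[OF p, of e "K e" Z] p_skew[OF p, of e e "K Z"] p_skew[OF p, of "K e" "K e" "K Z"]
    by (simp add: q')
  \<comment> \<open>\<open>skew_form_dim8_eq_0\<close> moves the first structure between arguments
    and contracts with the second: here \<open>I\<close> and \<open>K\<close>.\<close>
  interpret s: quaternion_form h I K "\<lambda>x. - J x"
    by (rule quaternion_form.swap[OF quaternion_form.cyclic[OF cyclic]])
  have "p X Y Z = 0" for X Y Z
  proof (rule s.skew_form_dim8_eq_0[OF dim p_trilinear])
    fix X Y Z
    show "p X Y Z = - p Y X Z" using p_skew[OF p, of X Y Z] by simp
    show "p X Z Y = - p X Y Z" by (rule p_swap)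
    show "p X (I Y) Z = p X Y (I Z)" by (simp add: eqs)
  next
    fix E Z assume "orthonormal_basis h E"
    with q(2) have "(\<Sum>e\<in>E. q e e Z) = 0" unfolding traceless_def by blast
    then show "(\<Sum>e\<in>E. p e (K e) Z) = 0" by (simp add: trace sum_negf)
  qed
  then have "T X Y Z = 0" "U X Y Z = 0" for X Y Z using p_0 by auto
  then show flat by (intro flatI) (auto simp: S')
qed

text \<open>If \<open>p = 0\<close>, this is the component of \<open>q\<close> in \<open>W1 + W2\<close>. It determines \<open>S\<close>.\<close>

definition qh :: "'e \<Rightarrow> 'e \<Rightarrow> 'e \<Rightarrow> real" where
  "qh X Y Z = (S X Y (K Z) + S (J X) Y (I Z)) / 2"

lemma qh_trilinear: "trilinear qh"
proof -
  have "trilinear (\<lambda>X Y Z. (1/2) * S X Y (K Z) + (1/2) * S (J X) Y (I Z))"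
    by (intro trilinear_combine qsym_trilinear[OF S] linear_I linear_J linear_K linear_identity
        trilinear_compose[of S "\<lambda>x. x" "\<lambda>x. x" K] trilinear_compose[of S J "\<lambda>x. x" I])
  moreover have "qh = (\<lambda>X Y Z. (1/2) * S X Y (K Z) + (1/2) * S (J X) Y (I Z))"
    by (auto simp: qh_def fun_eq_iff)
  ultimately show ?thesis by simp
qed

lemma qh_swap: "qh X Z Y = - qh X Y Z"
  using qsym_swap[OF S, of X Z "K Y"] qsym_swap[OF S, of "J X" Z "I Y"] by (simp add: qh_def eqs field_simps)

lemma S_of_qh: "S X Y Z = - qh X (I Y) (J Z) - qh X Y (K Z)"
  by (simp add: qh_def eqs field_simps)

lemma qh_skew:
  assumes "\<And>X Y Z. p X Y Z = 0" "skew_anti J q"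
  shows "qh Y X Z = - qh X Y Z"
  using assms(2)[unfolded skew_anti_def, rule_format, of X Y Z] p_0[OF assms(1)]
  by (simp add: qh_def eqs field_simps)

text \<open>\<open>qh\<close> is totally skew, and its contraction with \<open>I\<close> at
  \<open>Z\<close> is the trace of \<open>q\<close> at \<open>I Z\<close>, because that trace may be
  averaged over \<open>e\<close> and \<open>J e\<close>.\<close>

lemma flat_0_W13:
  assumes dim: "DIM('e) = 8" and p: "\<And>X Y Z. p X Y Z = 0"
    and q: "skew_anti J q" "traceless h q"
  shows flat
proof -
  note U0 = p_0(2)[OF p]
  interpret s: quaternion_form h J I "\<lambda>x. - K x" by (rule swap)
  have "qh X Y Z = 0" for X Y Z
  proof (rule s.skew_form_dim8_eq_0[OF dim qh_trilinear])
    fix X Y Z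
    show "qh X Y Z = - qh Y X Z" using qh_skew[OF p q(1), of X Y Z] by simp
    show "qh X Z Y = - qh X Y Z" by (rule qh_swap)
    show "qh X (J Y) Z = qh X Y (J Z)" by (simp add: qh_def eqs field_simps)
  next
    fix E Z assume E: "orthonormal_basis h E"
    have "(\<Sum>e\<in>E. q e e (I Z)) = 0" using q(2) E unfolding traceless_def by blast
    moreover have "bilinear (\<lambda>X Y. q X Y (I Z))"
      using q_trilinear by (auto simp: trilinear_iff bilinear_def)
    ultimately have "(\<Sum>e\<in>E. q e e (I Z)) + (\<Sum>e\<in>E. q (J e) (J e) (I Z)) = 0"
      using J.sum_A[OF E, of "\<lambda>X Y. q X Y (I Z)"] by simp
    moreover have "qh e (I e) Z = (q e e (I Z) + q (J e) (J e) (I Z)) / 2" for e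
      by (simp add: qh_def eqs U0)
    ultimately show "(\<Sum>e\<in>E. qh e (I e) Z) = 0"
      by (simp only: sum.distrib sum_divide_distrib[symmetric])
  qed
  then show flat by (intro flat_p_S p) (simp add: S_of_qh)
qed

text \<open>The component of \<open>r\<close> in \<open>W1 + W2\<close> is a symmetric expression in
  the totally skew \<open>qh\<close>. It is therefore totally skew itself, and the cyclic condition
  on \<open>r\<close> kills it.\<close>

lemma flat_0_W134_W234:
  assumes p: "\<And>X Y Z. p X Y Z = 0" and q: "skew_anti J q" and r: "cyclic_anti K r"
  shows flat
proof -
  note T0 = p_0(1)[OF p]
  note skew = qh_skew[OF p q]
  define c where "c X Y Z = r X Y Z - r (K X) (K Y) Z" for X Y Z
  have c: "c X Y Z = - (qh (I X) Y Z + qh X (I Y) Z + qh X Y (I Z) + qh (I X) (I Y) (I Z))" for X Y Z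
    by (simp add: c_def qh_def eqs T0 field_simps)
  have "c Y X Z = - c X Y Z" "c X Z Y = - c X Y Z" for X Y Z
    using skew[of "I X" Y Z] skew[of X "I Y" Z] skew[of X Y "I Z"] skew[of "I X" "I Y" "I Z"]
      qh_swap[of "I X" Y Z] qh_swap[of X "I Y" Z] qh_swap[of X Y "I Z"]
      qh_swap[of "I X" "I Y" "I Z"] by (simp_all add: c)
  moreover have "c X Y Z + c Y Z X + c Z X Y = 0" for X Y Z
    using r[unfolded cyclic_anti_def, rule_format, of X Y Z] by (simp add: c_def)
  ultimately have "c X Y Z = 0" for X Y Z
    by (smt (verit))
  then have c0: "r X Y Z = r (K X) (K Y) Z" for X Y Z
    by (simp add: c_def)
  \<comment> \<open>The two instances equate \<open>S (K X) Y (K Z)\<close> with both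
    \<open>- S X Y Z\<close> and \<open>S X Y Z\<close>.\<close>
  have "S X Y Z = 0" for X Y Z
    using c0[of X Y "J Z"] c0[of X "J Y" Z] by (simp add: eqs T0)
  then show flat by (intro flat_p_S p)
qed

lemma flat_0_W123_W134:
  assumes dim: "DIM('e) = 8" and p: "\<And>X Y Z. p X Y Z = 0"
    and q: "traceless h q" and r: "skew_anti K r"
  shows flat
proof -
  note U0 = p_0(2)[OF p] and T0 = p_0(1)[OF p]
  \<comment> \<open>The component of \<open>r\<close> in \<open>W1 + W2\<close>, as
    \<open>T = 0\<close>. Its contraction with \<open>I\<close> turns out to be the trace of
    \<open>q\<close>.\<close>
  define b where "b X Y Z = (1/2) * S (K X) Y (I Z) + (- 1/2) * S X Y (J Z)" for X Y Z
  have b: "trilinear b" unfolding b_def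
    by (intro trilinear_combine qsym_trilinear[OF S] linear_I linear_J linear_K linear_identity
        trilinear_compose[of S "\<lambda>x. x" "\<lambda>x. x" J] trilinear_compose[of S K "\<lambda>x. x" I])
  interpret s: quaternion_form h K I J by (rule quaternion_form.cyclic[OF cyclic])
  have b0: "b X Y Z = 0" for X Y Z
  proof (rule s.skew_form_dim8_eq_0[OF dim b])
    fix X Y Z
    show "b X Y Z = - b Y X Z"
      using r[unfolded skew_anti_def, rule_format, of X Y Z] by (simp add: b_def eqs T0)
    show "b X Z Y = - b X Y Z"
      using qsym_swap[OF S, of X Z "J Y"] qsym_swap[OF S, of "K X" Z "I Y"] by (simp add: b_def eqs)
    show "b X (K Y) Z = b X Y (K Z)" by (simp add: b_def eqs)
  next
    fix E Z assume E: "orthonormal_basis h E"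
    have "(\<Sum>e\<in>E. q e e Z) = 0" using q E unfolding traceless_def by blast
    moreover have "bilinear (\<lambda>X Y. q X Y Z)"
      using q_trilinear by (auto simp: trilinear_iff bilinear_def)
    ultimately have "(\<Sum>e\<in>E. q e e Z) + (\<Sum>e\<in>E. q (K e) (K e) Z) = 0"
      using K.sum_A[OF E, of "\<lambda>X Y. q X Y Z"] by simp
    moreover have "b e (I e) Z = (q e e Z + q (K e) (K e) Z) / 2" for e
      by (simp add: b_def eqs U0)
    ultimately show "(\<Sum>e\<in>E. b e (I e) Z) = 0"
      by (simp only: sum.distrib sum_divide_distrib[symmetric])
  qed
  have "S X Y Z = b X Y (J Z) - b X (I Y) (K Z)" for X Y Z
    by (simp add: b_def eqs)
  then show flat using b0 by (intro flat_p_S p) simp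
qed

end

section \<open>Traces of tensors of type \<open>W4\<close>\<close>

context quaternion_form
begin

context
  fixes \<beta> :: "'e \<Rightarrow> real" and E
  assumes \<beta>: "linear \<beta>" and E: "orthonormal_basis h E"
begin

text \<open>The first term contributes the dimension, the second and the fourth contribute -1 each,
  and the third vanishes because \<open>J\<close> is skew.\<close>

lemma lee_trace: "(\<Sum>e\<in>E. lee_form h J \<beta> e e Z) = (real DIM('e) - 2) * \<beta> Z"
proof -
  have "linear (\<lambda>x. \<beta> (J x))" using linear_compose[OF linear_J \<beta>] by (simp add: o_def)
  note sums = orthonormal_basis_sum[OF E \<beta>] orthonormal_basis_sum[OF E this]
  have "(\<Sum>e\<in>E. lee_form h J \<beta> e e Z)
      = (\<Sum>e\<in>E. h e e) * \<beta> Z - (\<Sum>e\<in>E. h e Z * \<beta> e) + (\<Sum>e\<in>E. h e (J Z) * \<beta> (J e))"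
    by (simp add: lee_form_def sum.distrib sum_subtractf sum_distrib_right)
  then show ?thesis
    by (simp add: sums sum_trace[OF E] quat linear_neg[OF \<beta>] left_diff_distrib)
qed

lemma lee_trace_I:
  "(\<Sum>e\<in>E. lee_form h J \<beta> e (I e) Z) = 0" "(\<Sum>e\<in>E. lee_form h J \<beta> (I e) e Z) = 0"
proof -
  have "linear (\<lambda>x. \<beta> (I x))" "linear (\<lambda>x. \<beta> (J x))" "linear (\<lambda>x. \<beta> (K x))"
    using linear_compose[OF linear_I \<beta>] linear_compose[OF linear_J \<beta>] linear_compose[OF linear_K \<beta>]
    by (simp_all add: o_def)
  note sums = orthonormal_basis_sum[OF E \<beta>] this[THEN orthonormal_basis_sum[OF E]]
  have "(\<Sum>e\<in>E. lee_form h J \<beta> e (I e) Z)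
      = - (\<Sum>e\<in>E. h e Z * \<beta> (I e)) - (\<Sum>e\<in>E. h e (J Z) * \<beta> (K e))"
    by (simp add: lee_form_def quat hq linear_neg[OF \<beta>] sum.distrib sum_subtractf sum_negf)
  then show "(\<Sum>e\<in>E. lee_form h J \<beta> e (I e) Z) = 0"
    by (simp add: sums quat linear_neg[OF \<beta>])
  have "(\<Sum>e\<in>E. lee_form h J \<beta> (I e) e Z)
      = (\<Sum>e\<in>E. h e (I Z) * \<beta> e) - (\<Sum>e\<in>E. h e (K Z) * \<beta> (J e))"
    by (simp add: lee_form_def quat hq linear_neg[OF \<beta>] sum.distrib sum_subtractf sum_negf)
  then show "(\<Sum>e\<in>E. lee_form h J \<beta> (I e) e Z) = 0"
    by (simp add: sums quat linear_neg[OF \<beta>])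
qed

end

lemma lee_trilinear:
  assumes "linear \<beta>"
  shows "trilinear (lee_form h J \<beta>)"
  unfolding trilinear_iff lee_form_def
  by (intro conjI allI linearI)
    (simp_all add: h_simps linear_add[OF linear_J] linear_scale[OF linear_J] linear_add[OF assms]
      linear_scale[OF assms] algebra_simps)

end

section \<open>Criteria for flatness in which a one-form of type \<open>W4\<close> has to
  vanish\<close>

context torsion_form
begin

lemma flat_q_lee_0:
  assumes "\<And>X Y Z. q X Y Z = lee_form h J \<beta> X Y Z" "\<And>z. \<beta> z = 0"
    "vanishing_herm I p \<or> vanishing_anti I p"
  shows flat
  using assms(3) by (auto intro: flat_q_herm flat_q_anti simp: assms(1,2) lee_form_def)

lemma flat_S_lee_0:
  assumes "\<And>X Y Z. p X Y Z = 0" "\<And>X Y Z. q X Y Z + q (J X) (J Y) Z = 2 * lee_form h J \<beta> X Y Z"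
    "\<And>z. \<beta> z = 0"
  shows flat
proof (rule flat_p_herm[OF assms(1)])
  show "vanishing_herm J q" by (simp add: vanishing_herm_def assms(2,3) lee_form_def)
qed

text \<open>\<open>q\<close> determines \<open>U\<close>, and \<open>U = T \<circ> I\<close> then
  gives \<open>T\<close>.\<close>

lemma p_of_q_herm:
  assumes "vanishing_herm I p"
  shows "p X Y Z = (q X Y (K Z) - q X (I Y) (J Z) - q (I X) Y (J Z) - q (I X) (I Y) (K Z)) / 2"
  by (simp add: eqs U_herm[OF assms])

lemma p_of_q_anti:
  assumes "vanishing_anti I p"
  shows "p X Y Z = (q X Y (K Z) - q X (I Y) (J Z) + q (I X) Y (J Z) + q (I X) (I Y) (K Z)) / 2"
  by (simp add: eqs U_anti[OF assms])

lemma q_lee: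
  assumes "vanishing_anti J q" "herm_lee h J q"
  obtains \<beta> where "linear \<beta>" "\<And>X Y Z. q X Y Z = lee_form h J \<beta> X Y Z"
proof -
  obtain \<beta> where "linear \<beta>"
    "\<And>X Y Z. q X Y Z + q (J X) (J Y) Z = 2 * lee_form h J \<beta> X Y Z"
    using assms(2) unfolding herm_lee_def by blast
  with assms(1) that show thesis by (simp add: vanishing_anti_def)
qed

text \<open>If \<open>z\<close> is orthogonal to the quaternionic line of a unit vector \<open>x\<close>, then \<open>\<beta> z\<close> can be read off from
  the values at permutations of \<open>(x, z, K x)\<close>.\<close>

lemma flat_W12_W4:
  assumes dim: "4 < DIM('e)" and p: "vanishing_herm I p" "skew_anti I p \<or> cyclic_anti I p"
    and q: "vanishing_anti J q" "herm_lee h J q"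
  shows flat
proof -
  obtain \<beta> where \<beta>: "linear \<beta>" and q': "\<And>X Y Z. q X Y Z = lee_form h J \<beta> X Y Z"
    using q_lee[OF q] by blast
  have p': "p X Y Z = - p (I X) (I Y) Z" for X Y Z
    using p(1)[unfolded vanishing_herm_def, rule_format, of X Y Z] by linarith
  have "\<beta> z = 0" for z
  proof -
    obtain x where x: "h x x = 1" "qorth x z" using ex_qorth[OF dim] by blast
    note orth = x(2)[unfolded qorth_def] qorth_sym[OF x(2), unfolded qorth_def]
    \<comment> \<open>Skewness of \<open>p\<close> would make the first two values opposite. The
      cyclic sum, which \<open>cyclic_anti\<close> doubles, is \<open>2 * \<beta> z\<close>.\<close>
    have *: "p x z (K x) = \<beta> z" "p z x (K x) = 0" "p z (K x) x = 0" "p (K x) x z = \<beta> z"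
      by (simp_all add: p_of_q_herm[OF p(1)] q' lee_form_def quat hq orth x(1) linear_neg[OF \<beta>])
    show ?thesis
      using p(2)
    proof
      assume "skew_anti I p"
      from p_skew[OF p(1) this, of x z "K x"] show ?thesis using * by simp
    next
      assume "cyclic_anti I p"
      from this[unfolded cyclic_anti_def, rule_format, of x z "K x"] show ?thesis
        using * p'[of x z "K x"] p'[of z "K x" x] p'[of "K x" x z] by simp
    qed
  qed
  then show flat using p(1) by (intro flat_q_lee_0[OF q']) auto
qed

text \<open>The contractions of \<open>lee_form\<close> with \<open>I\<close> vanish, so the trace
  of \<open>p\<close> at \<open>Z\<close> is \<open>DIM('e) - 2\<close> times
  \<open>\<beta> (K Z)\<close>.\<close>

lemma flat_W3_W4:
  assumes dim: "4 < DIM('e)" and p: "vanishing_anti I p" "traceless h p"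
    and q: "vanishing_anti J q" "herm_lee h J q"
  shows flat
proof -
  obtain \<beta> where \<beta>: "linear \<beta>" and q': "\<And>X Y Z. q X Y Z = lee_form h J \<beta> X Y Z"
    using q_lee[OF q] by blast
  obtain E where E: "orthonormal_basis h E" using ex_orthonormal_basis by blast
  have "\<beta> (K Z) = 0" for Z
  proof -
    have "0 = (\<Sum>e\<in>E. p e e Z)" using p(2) E unfolding traceless_def by simp
    also have "\<dots> = ((\<Sum>e\<in>E. q e e (K Z)) - (\<Sum>e\<in>E. q e (I e) (J Z)) + (\<Sum>e\<in>E. q (I e) e (J Z))
        + (\<Sum>e\<in>E. q (I e) (I e) (K Z))) / 2"
      unfolding p_of_q_anti[OF p(1)]
      by (simp only: sum.distrib sum_subtractf sum_divide_distrib[symmetric])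
    also have "(\<Sum>e\<in>E. q (I e) (I e) (K Z)) = (\<Sum>e\<in>E. q e e (K Z))"
      using I.sum_A[OF E, of "\<lambda>X Y. q X Y (K Z)"] q_trilinear
      by (simp add: trilinear_iff bilinear_def)
    finally show ?thesis
      using dim by (simp add: q' lee_trace[OF \<beta> E] lee_trace_I[OF \<beta> E])
  qed
  then have "\<beta> z = 0" for z
    using linear_neg[OF \<beta>, of z] by (metis K_K neg_equal_0_iff_equal)
  then show flat using p(1) by (intro flat_q_lee_0[OF q']) auto
qed

text \<open>Both instances contain the same term in \<open>S (J X)\<close>, which cancels in their
  difference.\<close>

lemma S_of_lee:
  assumes "\<And>X Y Z. q X Y Z + q (J X) (J Y) Z = 2 * lee_form h J \<beta> X Y Z" "\<And>X Y Z. p X Y Z = 0"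
  shows "S X Y (K Z) = lee_form h J \<beta> X Y Z - lee_form h J \<beta> X (I Y) (I Z)"
  using assms(1)[of X Y Z] assms(1)[of X "I Y" "I Z"] by (simp add: eqs p_0(2)[OF assms(2)])

text \<open>As \<open>p = 0\<close>, the one-form determines \<open>S\<close>, hence also the
  component of \<open>q\<close> in \<open>W1 + W2\<close>. The condition on that component,
  evaluated at \<open>x\<close>, \<open>z\<close>, \<open>K x\<close>, gives
  \<open>\<beta> (K z) = 0\<close>.\<close>

lemma flat_0_W14_W24:
  assumes dim: "4 < DIM('e)" and p: "\<And>X Y Z. p X Y Z = 0"
    and q: "herm_lee h J q" "skew_anti J q \<or> cyclic_anti J q"
  shows flat
proof -
  obtain \<beta> where \<beta>: "linear \<beta>"
    and q': "\<And>X Y Z. q X Y Z + q (J X) (J Y) Z = 2 * lee_form h J \<beta> X Y Z"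
    using q(1) unfolding herm_lee_def by blast
  have "q X Y Z = S X Y (K Z)" for X Y Z
    by (simp add: q_eq p_0(2)[OF p])
  then have q'': "q X Y Z - q (J X) (J Y) Z = - 2 * lee_form h J \<beta> X (I Y) (I Z)" for X Y Z
    using q'[of X Y Z] S_of_lee[OF q' p, of X Y Z] by simp
  have "\<beta> (K z) = 0" for z
  proof -
    obtain x where x: "h x x = 1" "qorth x z" using ex_qorth[OF dim] by blast
    note orth = x(2)[unfolded qorth_def] qorth_sym[OF x(2), unfolded qorth_def]
    note val = lee_form_def quat hq orth x(1) linear_neg[OF \<beta>]
    show ?thesis
      using q(2)
    proof
      assume "skew_anti J q"
      from this[unfolded skew_anti_def, rule_format, of x z "K x"] q''[of x z "K x"] q''[of z x "K x"]
      show ?thesis by (simp add: val)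
    next
      assume "cyclic_anti J q"
      from this[unfolded cyclic_anti_def, rule_format, of x z "K x"] q''[of x z "K x"]
        q''[of z "K x" x] q''[of "K x" x z]
      show ?thesis by (simp add: val)
    qed
  qed
  then have "\<beta> z = 0" for z
    using linear_neg[OF \<beta>, of z] by (metis K_K neg_equal_0_iff_equal)
  then show flat by (rule flat_S_lee_0[OF p q'])
qed

lemma r_of_lee:
  assumes "\<And>X Y Z. q X Y Z + q (J X) (J Y) Z = 2 * lee_form h J \<beta> X Y Z" "\<And>X Y Z. p X Y Z = 0"
    "linear \<beta>"
  shows "r X Y Z = - lee_form h J \<beta> X Y (I Z) - lee_form h J \<beta> X (I Y) Z"
  using S_of_lee[OF assms(1,2), of X Y "I Z"]
  by (simp add: r_eq p_0(1)[OF assms(2)] quat trilinear_minus[OF lee_trilinear[OF assms(3)]])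

text \<open>The one-form also determines \<open>r\<close>. The alternatives exclude
  \<open>W4\<close>, \<open>W2\<close> or \<open>W1\<close> from \<open>r\<close>: the first is
  tested by a trace, the others at \<open>x\<close>, \<open>z\<close>, \<open>I x\<close>.\<close>

lemma flat_0_W124:
  assumes dim: "4 < DIM('e)" and p: "\<And>X Y Z. p X Y Z = 0"
    and q: "herm_lee h J q" and r: "traceless h r \<or> skew_anti K r \<or> cyclic_anti K r"
  shows flat
proof -
  obtain \<beta> where \<beta>: "linear \<beta>"
    and q': "\<And>X Y Z. q X Y Z + q (J X) (J Y) Z = 2 * lee_form h J \<beta> X Y Z"
    using q(1) unfolding herm_lee_def by blast
  note r' = r_of_lee[OF q' p \<beta>]
  have "\<beta> z = 0" for z
  proof (cases "traceless h r")
    case True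
    obtain E where E: "orthonormal_basis h E" using ex_orthonormal_basis by blast
    have "0 = (\<Sum>e\<in>E. r e e (I z))" using True E unfolding traceless_def by simp
    also have "\<dots> = - (\<Sum>e\<in>E. lee_form h J \<beta> e e (I (I z))) - (\<Sum>e\<in>E. lee_form h J \<beta> e (I e) (I z))"
      by (simp only: r' sum_subtractf sum_negf)
    finally show ?thesis
      using dim by (simp add: lee_trace[OF \<beta> E] lee_trace_I[OF \<beta> E] I_I linear_neg[OF \<beta>])
  next
    case False
    obtain x where x: "h x x = 1" "qorth x z" using ex_qorth[OF dim] by blast
    note orth = x(2)[unfolded qorth_def] qorth_sym[OF x(2), unfolded qorth_def]
    note val = r' lee_form_def quat hq orth x(1) linear_neg[OF \<beta>]
    from r False show ?thesis
    proof (elim disjE)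
      assume "skew_anti K r"
      from this[unfolded skew_anti_def, rule_format, of x z "I x"]
      show ?thesis by (simp add: val)
    next
      assume "cyclic_anti K r"
      from this[unfolded cyclic_anti_def, rule_format, of x z "I x"]
      show ?thesis by (simp add: val)
    qed simp
  qed
  then show flat by (rule flat_S_lee_0[OF p q'])
qed

end

text \<open>\<open>S\<close> and \<open>T\<close> are read off from \<open>q\<close> and
  \<open>p\<close>. \<open>U\<close> can be read off from either, and the two formulas for
  \<open>r\<close>, which come from \<open>K = I J\<close> and \<open>K = - J I\<close>, make the
  results agree.\<close>

lemma (in quaternion_form) torsion_formI:
  assumes tri: "trilinear p" "trilinear q"
    and p: "\<And>X Y Z. p X Z Y = - p X Y Z" "\<And>X Y Z. p X (I Y) Z = p X Y (I Z)"
    and q: "\<And>X Y Z. q X Z Y = - q X Y Z" "\<And>X Y Z. q X (J Y) Z = q X Y (J Z)"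
    and r: "\<And>X Y Z. r X Y Z = p X Y (J Z) - q X (I Y) Z"
      "\<And>X Y Z. r X Y Z = p X (J Y) Z - q X Y (I Z)"
  shows "\<exists>S T U. torsion_form h I J K p q r S T U"
proof -
  note neg = trilinear_minus[OF tri(1)] trilinear_minus[OF tri(2)]
  define S where "S X Y Z = (1/2) * q X (K Y) Z + (- 1/2) * q X Y (K Z)" for X Y Z
  define T where "T X Y Z = (1/2) * p X Y (K Z) + (- 1/2) * p X (K Y) Z" for X Y Z
  define U where "U X Y Z = (1/2) * q X Y (I Z) + (- 1/2) * q X (I Y) Z" for X Y Z
  \<comment> \<open>The definition by \<open>q\<close> shows that \<open>U\<close> commutes with
    \<open>I\<close>, this one by \<open>p\<close> that it commutes with \<open>J\<close>.\<close>
  have U': "U X Y Z = (1/2) * p X (J Y) Z + (- 1/2) * p X Y (J Z)" for X Y Z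
    using r[of X Y Z] by (simp add: U_def)
  have tri': "trilinear S" "trilinear T" "trilinear U"
    unfolding S_def T_def U_def
    by (intro trilinear_combine tri linear_I linear_K linear_identity
        trilinear_compose[where b=q and f="\<lambda>x. x" and g="\<lambda>x. x" and k=K]
        trilinear_compose[where b=q and f="\<lambda>x. x" and g=K and k="\<lambda>x. x"]
        trilinear_compose[where b=p and f="\<lambda>x. x" and g="\<lambda>x. x" and k=K]
        trilinear_compose[where b=p and f="\<lambda>x. x" and g=K and k="\<lambda>x. x"]
        trilinear_compose[where b=q and f="\<lambda>x. x" and g="\<lambda>x. x" and k=I]
        trilinear_compose[where b=q and f="\<lambda>x. x" and g=I and k="\<lambda>x. x"])+
  have swap': "S X Z Y = S X Y Z" "T X Z Y = T X Y Z" "U X Z Y = U X Y Z" for X Y Z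
    using p(1)[of X Y "K Z"] p(1)[of X "K Y" Z] q(1)[of X Y "K Z"] q(1)[of X "K Y" Z]
      q(1)[of X Y "I Z"] q(1)[of X "I Y" Z]
    by (simp_all add: S_def T_def U_def)
  have S': "S X (I Y) Z = - S X Y (I Z)" "S X (J Y) Z = - S X Y (J Z)" for X Y Z
    using q(2)[of X "I Y" "K Z"] q(2)[of X "K Y" Z] q(2)[of X "I Y" "I Z"]
    by (simp_all add: S_def quat neg q(2))
  have T': "T X (I Y) Z = - T X Y (I Z)" "T X (J Y) Z = - T X Y (J Z)" for X Y Z
    using p(2)[of X "J Y" "K Z"] p(2)[of X "K Y" Z] p(2)[of X "J Y" "J Z"]
    by (simp_all add: T_def quat neg p(2))
  have U'': "U X (I Y) Z = - U X Y (I Z)" for X Y Z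
    by (simp add: U_def quat neg)
  have Uj: "U X (J Y) Z = - U X Y (J Z)" for X Y Z
    by (simp add: U' quat neg)
  have p': "p X Y Z = U X Y (J Z) - T X Y (K Z)" for X Y Z
    using p(2)[of X "J Y" "J Z"] p(2)[of X "J Y" "K Z"] p(2)[of X "J Y" "I (J Z)"]
    by (simp add: U' T_def quat neg)
  have q': "q X Y Z = S X Y (K Z) - U X Y (I Z)" for X Y Z
    using q(2)[of X "I Y" "I Z"] q(2)[of X "I Y" "K Z"] q(2)[of X "I Y" "J (I Z)"]
    by (simp add: U_def S_def quat neg)
  have r': "r X Y Z = T X Y (I Z) - S X Y (J Z)" for X Y Z
    using r(1)[of X Y Z] p'[of X Y "J Z"] q'[of X "I Y" Z]
    by (simp add: quat S' U'' trilinear_minus[OF tri'(1)] trilinear_minus[OF tri'(2)]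
        trilinear_minus[OF tri'(3)])
  have "qsym S" "qsym T" "qsym U"
    unfolding qsym_def by (intro conjI allI tri' swap' S' T' U'' Uj)+
  then have "torsion_form h I J K p q r S T U"
    by (intro torsion_form.intro torsion_form_axioms.intro quaternion_form_axioms p' q' r')
  then show ?thesis by blast
qed

section \<open>Covariant derivatives\<close>

lemma frechet_derivative_cong_open:
  assumes "open G" "x \<in> G" "\<And>y. y \<in> G \<Longrightarrow> f y = f' y"
  shows "frechet_derivative f (at x) = frechet_derivative f' (at x)"
proof -
  have "(f has_derivative D) (at x) \<longleftrightarrow> (f' has_derivative D) (at x)" for D
    using has_derivative_transform_within_open[OF _ assms(1,2)] assms(3) by metis
  then show ?thesis by (simp add: frechet_derivative_def)
qed

lemma smooth_on_has_derivative:
  assumes "smooth_on G f" "x \<in> G"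
  shows "(f has_derivative frechet_derivative f (at x)) (at x)"
proof -
  have "C_k_on (Suc 0) f G" using assms(1) unfolding smooth_on_def by blast
  then show ?thesis using assms(2) by (simp add: frechet_derivative_works)
qed

text \<open>A product rule that needs derivatives of \<open>L\<close> only at fixed vectors, as
  smoothness of tensor fields is stated in that form. Expanding in \<open>Basis\<close> reduces it
  to sums of products.\<close>

lemma has_derivative_linear_family:
  fixes L :: "'a::real_normed_vector \<Rightarrow> 'e::euclidean_space \<Rightarrow> 'b::real_normed_vector"
  assumes G: "open G" "x \<in> G" and lin: "\<And>y. y \<in> G \<Longrightarrow> linear (L y)"
    and L: "\<And>w. ((\<lambda>y. L y w) has_derivative L' w) (at x)" and v: "(v has_derivative v') (at x)"
  shows "((\<lambda>y. L y (v y)) has_derivative (\<lambda>X. L' (v x) X + L x (v' X))) (at x)"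
proof -
  have expand: "L y w = (\<Sum>b\<in>Basis. (w \<bullet> b) *\<^sub>R L y b)" if "y \<in> G" for y w
  proof -
    have "L y w = L y (\<Sum>b\<in>Basis. (w \<bullet> b) *\<^sub>R b)" by (simp add: euclidean_representation)
    then show ?thesis using lin[OF that] by (simp add: linear_sum linear_scale)
  qed
  have "((\<lambda>y. \<Sum>b\<in>Basis. (w \<bullet> b) *\<^sub>R L y b) has_derivative (\<lambda>X. \<Sum>b\<in>Basis. (w \<bullet> b) *\<^sub>R L' b X)) (at x)"
    for w by (intro derivative_intros L)
  then have "((\<lambda>y. L y w) has_derivative (\<lambda>X. \<Sum>b\<in>Basis. (w \<bullet> b) *\<^sub>R L' b X)) (at x)" for w
    by (rule has_derivative_transform_within_open[OF _ G]) (simp add: expand)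
  \<comment> \<open>Uniqueness of derivatives makes \<open>L'\<close> linear in
    \<open>w\<close>.\<close>
  then have L': "L' w = (\<lambda>X. \<Sum>b\<in>Basis. (w \<bullet> b) *\<^sub>R L' b X)" for w
    using has_derivative_unique L by blast
  have "((\<lambda>y. \<Sum>b\<in>Basis. (v y \<bullet> b) *\<^sub>R L y b) has_derivative
      (\<lambda>X. \<Sum>b\<in>Basis. (v x \<bullet> b) *\<^sub>R L' b X + (v' X \<bullet> b) *\<^sub>R L x b)) (at x)"
    by (intro derivative_intros L v)
  then have "((\<lambda>y. L y (v y)) has_derivative
      (\<lambda>X. \<Sum>b\<in>Basis. (v x \<bullet> b) *\<^sub>R L' b X + (v' X \<bullet> b) *\<^sub>R L x b)) (at x)"
    by (rule has_derivative_transform_within_open[OF _ G]) (simp add: expand)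
  moreover have "(\<lambda>X. L' (v x) X + L x (v' X))
      = (\<lambda>X. \<Sum>b\<in>Basis. (v x \<bullet> b) *\<^sub>R L' b X + (v' X \<bullet> b) *\<^sub>R L x b)"
  proof
    fix X
    have "L' (v x) X = (\<Sum>b\<in>Basis. (v x \<bullet> b) *\<^sub>R L' b X)" by (subst L') simp
    then show "L' (v x) X + L x (v' X)
        = (\<Sum>b\<in>Basis. (v x \<bullet> b) *\<^sub>R L' b X + (v' X \<bullet> b) *\<^sub>R L x b)"
      using expand[OF G(2), of "v' X"] by (simp only: sum.distrib)
  qed
  ultimately show ?thesis by simp
qed

text \<open>\<open>cov \<Gamma> A c x X Z\<close> represents \<open>(\<nabla>\<^sub>X A) Z\<close>.\<close>

definition cov ::
  "('m, 'e::euclidean_space) christoffel \<Rightarrow> ('m, 'e) endomorphism \<Rightarrow>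
   ('m, 'e) chart \<Rightarrow> 'e \<Rightarrow> 'e \<Rightarrow> 'e \<Rightarrow> 'e" where
  "cov \<Gamma> A c x X Z =
     frechet_derivative (\<lambda>y. A c y Z) (at x) X + \<Gamma> c x X (A c x Z) - A c x (\<Gamma> c x X Z)"

lemma cov_cong:
  assumes "open (chart_image c)" "x \<in> chart_image c"
    "\<And>y Z. y \<in> chart_image c \<Longrightarrow> A c y Z = B c y Z"
  shows "cov \<Gamma> A c x X Z = cov \<Gamma> B c x X Z"
  using assms(2,3) frechet_derivative_cong_open[OF assms(1,2), of "\<lambda>y. A c y Z" "\<lambda>y. B c y Z"]
  by (simp add: cov_def)

lemma cov_minus:
  assumes "bilinear (\<Gamma> c x)" "(\<lambda>y. A c y Z) differentiable (at x)"
  shows "cov \<Gamma> (\<lambda>c y Z. - A c y Z) c x X Z = - cov \<Gamma> A c x X Z"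
proof -
  have "((\<lambda>y. - A c y Z) has_derivative (\<lambda>X. - frechet_derivative (\<lambda>y. A c y Z) (at x) X)) (at x)"
    using assms(2) by (intro derivative_intros) (simp flip: frechet_derivative_works)
  from frechet_derivative_at[OF this, symmetric] show ?thesis
    by (simp add: cov_def bilinear_rneg[OF assms(1)])
qed

lemma cov_minus_id:
  assumes "bilinear (\<Gamma> c x)"
  shows "cov \<Gamma> (\<lambda>c y Z. - Z) c x X Z = 0"
  by (simp add: cov_def bilinear_rneg[OF assms])

lemma cov_compose:
  fixes A B :: "('m, 'e::euclidean_space) endomorphism"
  assumes G: "open (chart_image c)" "x \<in> chart_image c"
    and A: "\<And>y. y \<in> chart_image c \<Longrightarrow> linear (A c y)" "\<And>v. smooth_on (chart_image c) (\<lambda>x. A c x v)"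
    and B: "\<And>v. smooth_on (chart_image c) (\<lambda>x. B c x v)"
  shows "cov \<Gamma> (\<lambda>c y Z. A c y (B c y Z)) c x X Z = cov \<Gamma> A c x X (B c x Z) + A c x (cov \<Gamma> B c x X Z)"
proof -
  note l = linear_add[OF A(1)[OF G(2)]] linear_diff[OF A(1)[OF G(2)]]
  have "((\<lambda>y. A c y (B c y Z)) has_derivative (\<lambda>X. frechet_derivative (\<lambda>y. A c y (B c x Z)) (at x) X
      + A c x (frechet_derivative (\<lambda>y. B c y Z) (at x) X))) (at x)"
    by (intro has_derivative_linear_family[OF G A(1)] smooth_on_has_derivative[OF A(2) G(2)]
        smooth_on_has_derivative[OF B G(2)])
  from frechet_derivative_at[OF this, symmetric] show ?thesis
    by (simp add: cov_def l)
qed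

section \<open>The covariant derivatives of \<open>I\<close>, \<open>J\<close>, \<open>K\<close> on
  the manifold\<close>

context almost_hyper_hermitian
begin

context
  fixes \<Gamma> c x
  assumes lc: "levi_civita atlas g \<Gamma>" and c: "c \<in> atlas" and x: "x \<in> chart_image c"
begin

lemma open_chart: "open (chart_image c)"
  using c by (rule open_image)

lemma bilinear_christoffel: "bilinear (\<Gamma> c x)"
  using lc c x by (simp add: levi_civita_def affine_connection_def)

lemma g_bilinear: "y \<in> chart_image c \<Longrightarrow> bilinear (g c y)"
  using metric c by (simp add: riemannian_metric_def tensor2_field_def)

lemma g_smooth: "smooth_on (chart_image c) (\<lambda>x. g c x u v)"
  using metric c by (simp add: riemannian_metric_def tensor2_field_def)

lemma g_sym: "y \<in> chart_image c \<Longrightarrow> g c y u v = g c y v u"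
  using metric c unfolding riemannian_metric_def by blast

lemma endomorphism:
  assumes "A \<in> {I, J, K}"
  shows "y \<in> chart_image c \<Longrightarrow> linear (A c y)" "smooth_on (chart_image c) (\<lambda>x. A c x v)"
  using assms endomorphisms c by (auto simp: endomorphism_field_def)

lemma quaternion_form_point: "quaternion_form (g c x) (I c x) (J c x) (K c x)"
proof
  show "bilinear (g c x)" using x by (rule g_bilinear)
  show "g c x u v = g c x v u" for u v using x by (rule g_sym)
  show "0 < g c x u u" if "u \<noteq> 0" for u
    using metric c x that by (simp add: riemannian_metric_def)
  show "I c x (I c x v) = - v" "J c x (J c x v) = - v" "I c x (J c x v) = K c x v"
    "J c x (I c x v) = - K c x v" for v
    using I_squared J_squared K_eq(1) K_eq(2)[of c x v] c x by auto
  show "g c x (I c x u) (I c x v) = g c x u v" "g c x (J c x u) (J c x v) = g c x u v" for u v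
    using hermitian c x by auto
qed (use endomorphism x in \<open>auto intro!: linear_add linear_scale\<close>)

lemma square:
  assumes "A \<in> {I, J, K}" "y \<in> chart_image c"
  shows "A c y (A c y v) = - v"
proof -
  have "K c y (K c y v) = - v"
    using K_eq[OF c assms(2)] I_squared[OF c assms(2)] J_squared[OF c assms(2)]
    by (metis add.inverse_inverse)
  then show ?thesis using assms I_squared[OF c assms(2)] J_squared[OF c assms(2)] by auto
qed

text \<open>Leibniz rule for \<open>omega\<close>; the term with the derivative of \<open>g\<close>
  drops out because the connection is metric.\<close>

lemma nabla_omega:
  assumes A: "A \<in> {I, J, K}"
  shows "nabla \<Gamma> (omega g A) c x X Y Z = g c x Y (cov \<Gamma> A c x X Z)"
proof -
  note l = bilinear_radd[OF g_bilinear[OF x]] bilinear_rsub[OF g_bilinear[OF x]]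
  have "((\<lambda>y. g c y Y (A c y Z)) has_derivative (\<lambda>X. frechet_derivative (\<lambda>y. g c y Y (A c x Z)) (at x) X
      + g c x Y (frechet_derivative (\<lambda>y. A c y Z) (at x) X))) (at x)"
    using g_bilinear
    by (intro has_derivative_linear_family[OF open_chart x] smooth_on_has_derivative[OF g_smooth x]
        smooth_on_has_derivative[OF endomorphism(2)[OF A] x]) (simp add: bilinear_def)
  note * = frechet_derivative_at[OF this, symmetric]
  have "nabla \<Gamma> g c x X Y (A c x Z) = 0"
    using lc c x by (simp add: levi_civita_def)
  then show ?thesis
    by (simp add: nabla_def omega_def * cov_def l)
qed

lemma nabla_omega_skew:
  assumes A: "A \<in> {I, J, K}"
  shows "nabla \<Gamma> (omega g A) c x X Z Y = - nabla \<Gamma> (omega g A) c x X Y Z"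
proof -
  have skew: "omega g A c y Z Y = - omega g A c y Y Z" if y: "y \<in> chart_image c" for y Y Z
  proof -
    have "g c y Z (A c y Y) = g c y (A c y Z) (A c y (A c y Y))"
      using hermitian[OF A c y] by simp
    also have "\<dots> = - g c y (A c y Z) Y"
      by (simp add: square[OF A y] bilinear_rneg[OF g_bilinear[OF y]])
    finally show ?thesis using g_sym[OF y] by (simp add: omega_def)
  qed
  have "((\<lambda>y. omega g A c y Y Z) has_derivative (\<lambda>X. frechet_derivative (\<lambda>y. g c y Y (A c x Z)) (at x) X
      + g c x Y (frechet_derivative (\<lambda>y. A c y Z) (at x) X))) (at x)"
    unfolding omega_def
    using g_bilinear
    by (intro has_derivative_linear_family[OF open_chart x] smooth_on_has_derivative[OF g_smooth x]
        smooth_on_has_derivative[OF endomorphism(2)[OF A] x]) (simp add: bilinear_def)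
  then have d: "(\<lambda>y. omega g A c y Y Z) differentiable (at x)"
    unfolding differentiable_def by blast
  have "frechet_derivative (\<lambda>y. omega g A c y Z Y) (at x) = frechet_derivative (\<lambda>y. - omega g A c y Y Z) (at x)"
    by (rule frechet_derivative_cong_open[OF open_chart x skew])
  also have "\<dots> = (\<lambda>X. - frechet_derivative (\<lambda>y. omega g A c y Y Z) (at x) X)"
    using d by (intro frechet_derivative_at[symmetric] derivative_intros)
      (simp flip: frechet_derivative_works)
  finally show ?thesis
    using skew[OF x, of "\<Gamma> c x X Z" Y] skew[OF x, of Z "\<Gamma> c x X Y"] by (simp add: nabla_def)
qed

lemma nabla_omega_trilinear:
  assumes A: "A \<in> {I, J, K}"
  shows "trilinear (nabla \<Gamma> (omega g A) c x)"
proof -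
  have Y: "linear (\<lambda>Y. nabla \<Gamma> (omega g A) c x X Y Z)" for X Z
    unfolding nabla_omega[OF A] using g_bilinear[OF x] by (simp add: bilinear_def)
  have "linear (\<lambda>Z. - nabla \<Gamma> (omega g A) c x X Z Y)" for X Y
    by (intro linear_compose_neg Y)
  then have Z: "linear (nabla \<Gamma> (omega g A) c x X Y)" for X Y
    by (simp flip: nabla_omega_skew[OF A])
  have "linear (frechet_derivative (\<lambda>y. A c y Z) (at x))" for Z
    by (rule has_derivative_linear[OF smooth_on_has_derivative[OF endomorphism(2)[OF A] x]])
  moreover have "linear (\<lambda>X. \<Gamma> c x X Z)" for Z
    using bilinear_christoffel by (simp add: bilinear_def)
  ultimately have "linear (\<lambda>X. cov \<Gamma> A c x X Z)" for Z
    unfolding cov_def using linear_compose[OF _ endomorphism(1)[OF A x], unfolded o_def]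
    by (intro linear_compose_sub linear_compose_add) auto
  then have "linear (\<lambda>X. nabla \<Gamma> (omega g A) c x X Y Z)" for Y Z
    unfolding nabla_omega[OF A] using g_bilinear[OF x] linear_compose[of _ "g c x Y", unfolded o_def]
    by (auto simp: bilinear_def)
  with Y Z show ?thesis by (simp add: trilinear_iff)
qed

text \<open>Differentiating \<open>A (A Z) = - Z\<close> shows that the covariant derivative of
  \<open>A\<close> anticommutes with \<open>A\<close>.\<close>

lemma nabla_omega_A:
  assumes A: "A \<in> {I, J, K}"
  shows "nabla \<Gamma> (omega g A) c x X (A c x Y) Z = nabla \<Gamma> (omega g A) c x X Y (A c x Z)"
proof -
  have "cov \<Gamma> A c x X (A c x Z) + A c x (cov \<Gamma> A c x X Z) = 0"
    using cov_compose[where A=A and B=A and c=c, OF open_chart x endomorphism[OF A] endomorphism(2)[OF A], of \<Gamma> X Z]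
      cov_cong[OF open_chart x, of "\<lambda>c y Z. A c y (A c y Z)" "\<lambda>c y Z. - Z", OF square[OF A]]
    by (simp add: cov_minus_id[where \<Gamma>=\<Gamma> and c=c and x=x, OF bilinear_christoffel])
  then have *: "cov \<Gamma> A c x X (A c x Z) = - A c x (cov \<Gamma> A c x X Z)"
    by (simp add: eq_neg_iff_add_eq_0)
  have "g c x (A c x Y) (cov \<Gamma> A c x X Z) = g c x (A c x (A c x Y)) (A c x (cov \<Gamma> A c x X Z))"
    using hermitian[OF A c x] by simp
  then show ?thesis
    by (simp add: nabla_omega[OF A] * square[OF A x] bilinear_rneg[OF g_bilinear[OF x]]
        bilinear_lneg[OF g_bilinear[OF x]])
qed

text \<open>Leibniz rule for \<open>K = I J\<close> and for \<open>K = - J I\<close>; the skewness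
  of \<open>I\<close> and \<open>J\<close> moves the outer factor to the argument
  \<open>Y\<close>.\<close>

lemma nabla_omega_K:
  "nabla \<Gamma> (omega g K) c x X Y Z
     = nabla \<Gamma> (omega g I) c x X Y (J c x Z) - nabla \<Gamma> (omega g J) c x X (I c x Y) Z"
  "nabla \<Gamma> (omega g K) c x X Y Z
     = nabla \<Gamma> (omega g I) c x X (J c x Y) Z - nabla \<Gamma> (omega g J) c x X Y (I c x Z)"
proof -
  interpret quaternion_form "g c x" "I c x" "J c x" "K c x" by (rule quaternion_form_point)
  have IJK: "I \<in> {I, J, K}" "J \<in> {I, J, K}" "K \<in> {I, J, K}" by auto
  have "cov \<Gamma> K c x X Z = cov \<Gamma> (\<lambda>c y Z. I c y (J c y Z)) c x X Z"
    by (rule cov_cong[OF open_chart x]) (rule K_eq(1)[OF c])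
  also have "\<dots> = cov \<Gamma> I c x X (J c x Z) + I c x (cov \<Gamma> J c x X Z)"
    by (rule cov_compose[where A=I and B=J, OF open_chart x endomorphism[OF IJK(1)] endomorphism(2)[OF IJK(2)]])
  finally show "nabla \<Gamma> (omega g K) c x X Y Z
     = nabla \<Gamma> (omega g I) c x X Y (J c x Z) - nabla \<Gamma> (omega g J) c x X (I c x Y) Z"
    by (simp add: nabla_omega hq)
  have "cov \<Gamma> K c x X Z = cov \<Gamma> (\<lambda>c y Z. - J c y (I c y Z)) c x X Z"
    by (rule cov_cong[OF open_chart x]) (rule K_eq(2)[OF c])
  also have "\<dots> = - cov \<Gamma> (\<lambda>c y Z. J c y (I c y Z)) c x X Z"
  proof (rule cov_minus)
    show "bilinear (\<Gamma> c x)" by (rule bilinear_christoffel)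
    show "(\<lambda>y. J c y (I c y Z)) differentiable (at x)"
      using has_derivative_linear_family[OF open_chart x endomorphism(1)[OF IJK(2)]
          smooth_on_has_derivative[OF endomorphism(2)[OF IJK(2)] x]
          smooth_on_has_derivative[OF endomorphism(2)[OF IJK(1)] x]]
      unfolding differentiable_def by blast
  qed
  also have "cov \<Gamma> (\<lambda>c y Z. J c y (I c y Z)) c x X Z = cov \<Gamma> J c x X (I c x Z) + J c x (cov \<Gamma> I c x X Z)"
    by (rule cov_compose[where A=J and B=I, OF open_chart x endomorphism[OF IJK(2)] endomorphism(2)[OF IJK(1)]])
  finally show "nabla \<Gamma> (omega g K) c x X Y Z
     = nabla \<Gamma> (omega g I) c x X (J c x Y) Z - nabla \<Gamma> (omega g J) c x X Y (I c x Z)"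
    by (simp add: nabla_omega hq)
qed

lemma ex_torsion_form:
  "\<exists>S T U. torsion_form (g c x) (I c x) (J c x) (K c x) (nabla \<Gamma> (omega g I) c x)
     (nabla \<Gamma> (omega g J) c x) (nabla \<Gamma> (omega g K) c x) S T U"
  by (intro quaternion_form.torsion_formI[OF quaternion_form_point] nabla_omega_trilinear nabla_omega_skew
      nabla_omega_A nabla_omega_K) auto

end

end

section \<open>From the conditions at a point to the manifold\<close>

context torsion_form
begin

lemma flat_pointwise:
  assumes dim: "4 < DIM('e)" and hyp:
    "(p \<in> (W1 + W2) h I \<and> q \<in> (W1 + W2) h J \<and> r \<in> (W1 + W2) h K) \<or>
     (p \<in> W1 h I \<and> q \<in> W2 h J) \<or>
     ((\<forall>X Y Z. p X Y Z = 0) \<and> q \<in> (W1 + W2) h J) \<or>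
     (\<exists>C\<in>{W1, W2, W3}. p \<in> C h I \<and> q \<in> W4 h J) \<or>
     (\<exists>C\<in>{W1, W2, W3}. (\<forall>X Y Z. p X Y Z = 0) \<and> q \<in> (C + W4) h J) \<or>
     (\<exists>C\<in>{W1 + W2, W1 + W4, W2 + W4}. (\<forall>X Y Z. p X Y Z = 0) \<and>
        q \<in> (W1 + W2 + W4) h J \<and> r \<in> (C + W3) h K) \<or>
     ((\<forall>X Y Z. p X Y Z = 0) \<and> q \<in> (W1 + W3 + W4) h J \<and> r \<in> (W2 + W3 + W4) h K)"
  shows flat
  using hyp
proof (elim disjE bexE conjE)
  assume "p \<in> (W1 + W2) h I" "q \<in> (W1 + W2) h J" "r \<in> (W1 + W2) h K"
  then show flat by (intro flat_of_hermitian I.W12_herm[rule_format] J.W12_herm[rule_format] K.W12_herm[rule_format])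
next
  assume "p \<in> W1 h I" "q \<in> W2 h J"
  then show flat by (intro flat_W1_W2 I.W1(1,2) J.W2(1,2))
next
  assume "\<forall>X Y Z. p X Y Z = 0" "q \<in> (W1 + W2) h J"
  then show flat by (intro flat_p_herm J.W12_herm[rule_format]) auto
next
  fix C assume C: "C \<in> {W1, W2, W3}" and "p \<in> C h I" and q: "q \<in> W4 h J"
  then consider "p \<in> W1 h I" | "p \<in> W2 h I" | "p \<in> W3 h I" by auto
  then show flat
  proof cases
    case 1
    then show ?thesis using I.W1 q by (intro flat_W12_W4[OF dim] J.W4) auto
  next
    case 2
    then show ?thesis using I.W2 q by (intro flat_W12_W4[OF dim] J.W4) auto
  next
    case 3
    then show ?thesis using q by (intro flat_W3_W4[OF dim] J.W4(1,4) I.W3(1,4))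
  qed
next
  fix C assume C: "C \<in> {W1, W2, W3}" and p: "\<forall>X Y Z. p X Y Z = 0" and "q \<in> (C + W4) h J"
  then consider "q \<in> (W1 + W4) h J" | "q \<in> (W2 + W4) h J" | "q \<in> (W3 + W4) h J" by auto
  then show flat
  proof cases
    case 1
    then show ?thesis using p J.W14_lee[rule_format] J.W14_skew[rule_format]
      by (intro flat_0_W14_W24[OF dim]) auto
  next
    case 2
    then show ?thesis using p J.W24_lee[rule_format] J.W24_cyclic[rule_format]
      by (intro flat_0_W14_W24[OF dim]) auto
  next
    case 3
    then show ?thesis using p J.W34_anti[rule_format] by (intro flat_p_anti) auto
  qed
next
  fix C assume C: "C \<in> {W1 + W2, W1 + W4, W2 + W4}" and p: "\<forall>X Y Z. p X Y Z = 0"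
    and q: "q \<in> (W1 + W2 + W4) h J" and "r \<in> (C + W3) h K"
  then consider "r \<in> (W1 + W2 + W3) h K" | "r \<in> (W1 + W4 + W3) h K" | "r \<in> (W2 + W4 + W3) h K"
    by auto
  then have "traceless h r \<or> skew_anti K r \<or> cyclic_anti K r"
    using K.W123_traceless[rule_format] K.W143_skew[rule_format] K.W243_cyclic[rule_format] by cases auto
  then show flat using p q by (intro flat_0_W124[OF dim] J.W124_lee[rule_format]) auto
next
  assume "\<forall>X Y Z. p X Y Z = 0" and q: "q \<in> (W1 + W3 + W4) h J"
    and r: "r \<in> (W2 + W3 + W4) h K"
  then show flat by (intro flat_0_W134_W234[OF _ J.W134_skew[rule_format, OF q] K.W234_cyclic[rule_format, OF r]]) blast
qed

lemma flat_pointwise_dim8: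
  assumes dim: "DIM('e) = 8" and hyp:
    "(p \<in> W1 h I \<and> q \<in> W3 h J) \<or>
     ((\<forall>X Y Z. p X Y Z = 0) \<and> q \<in> (W1 + W3) h J) \<or>
     ((\<forall>X Y Z. p X Y Z = 0) \<and> q \<in> (W1 + W2 + W3) h J \<and> r \<in> (W1 + W3 + W4) h K)"
  shows flat
  using hyp
proof (elim disjE conjE)
  assume "p \<in> W1 h I" "q \<in> W3 h J"
  then show flat by (intro flat_W1_W3[OF dim] I.W1(1,2) J.W3(1,4))
next
  assume "\<forall>X Y Z. p X Y Z = 0" and q: "q \<in> (W1 + W3) h J"
  then show flat by (intro flat_0_W13[OF dim _ J.W13_skew[rule_format, OF q] J.W13_traceless[rule_format, OF q]]) blast
next
  assume "\<forall>X Y Z. p X Y Z = 0" and q: "q \<in> (W1 + W2 + W3) h J"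
    and r: "r \<in> (W1 + W3 + W4) h K"
  then show flat by (intro flat_0_W123_W134[OF dim _ J.W123_traceless[rule_format, OF q] K.W134_skew[rule_format, OF r]]) blast
qed

end

text \<open>The encoding forms \<open>S\<close>, \<open>T\<close>, \<open>U\<close> come from an
  existence statement at each point, so flatness is asked for whichever forms are obtained.\<close>

lemma (in almost_hyper_hermitian) hyperkaehlerI:
  assumes "levi_civita atlas g \<Gamma>"
    and "\<And>c x S T U. c \<in> atlas \<Longrightarrow> x \<in> chart_image c \<Longrightarrow>
      torsion_form (g c x) (I c x) (J c x) (K c x) (nabla \<Gamma> (omega g I) c x)
        (nabla \<Gamma> (omega g J) c x) (nabla \<Gamma> (omega g K) c x) S T U \<Longrightarrow>
      torsion_form.flat (nabla \<Gamma> (omega g I) c x)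
        (nabla \<Gamma> (omega g J) c x) (nabla \<Gamma> (omega g K) c x)"
  shows "hyperkaehler atlas \<Gamma> g I J K"
proof -
  have "nabla \<Gamma> (omega g I) c x X Y Z = 0 \<and> nabla \<Gamma> (omega g J) c x X Y Z = 0 \<and>
      nabla \<Gamma> (omega g K) c x X Y Z = 0" if cx: "c \<in> atlas" "x \<in> chart_image c" for c x X Y Z
  proof -
    obtain S T U where t: "torsion_form (g c x) (I c x) (J c x) (K c x) (nabla \<Gamma> (omega g I) c x)
        (nabla \<Gamma> (omega g J) c x) (nabla \<Gamma> (omega g K) c x) S T U"
      using ex_torsion_form[OF assms(1) cx] by blast
    from assms(2)[OF cx t] show ?thesis by (simp add: torsion_form.flat_def[OF t])
  qed
  then show ?thesis by (simp add: hyperkaehler_def nabla_omega_zero_def)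
qed

lemma bex_forward: "\<exists>x\<in>A. P x \<Longrightarrow> (\<And>x. x \<in> A \<Longrightarrow> P x \<Longrightarrow> Q x) \<Longrightarrow> \<exists>x\<in>A. Q x"
  by blast

theorem theorem4p2:
  fixes M :: "'m topology" and atlas :: "('m, 'e::euclidean_space) chart set"
    and g :: "('m, 'e) tensor2" and I J K :: "('m, 'e) endomorphism"
    and \<Gamma> :: "('m, 'e) christoffel" and n :: nat
  assumes "almost_hyper_hermitian M atlas g I J K"
    and "DIM('e) = 4 * n" and "n \<ge> 2"
    and "levi_civita atlas g \<Gamma>"
  shows
    "((nabla_omega_in atlas \<Gamma> g I (W1 + W2) \<and> nabla_omega_in atlas \<Gamma> g J (W1 + W2) \<and>
         nabla_omega_in atlas \<Gamma> g K (W1 + W2)) \<or>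
      (nabla_omega_in atlas \<Gamma> g I W1 \<and> nabla_omega_in atlas \<Gamma> g J W2) \<or>
      (nabla_omega_zero atlas \<Gamma> g I \<and> nabla_omega_in atlas \<Gamma> g J (W1 + W2)) \<or>
      (\<exists>C\<in>{W1, W2, W3}. nabla_omega_in atlas \<Gamma> g I C \<and> nabla_omega_in atlas \<Gamma> g J W4) \<or>
      (\<exists>C\<in>{W1, W2, W3}. nabla_omega_zero atlas \<Gamma> g I \<and> nabla_omega_in atlas \<Gamma> g J (C + W4)) \<or>
      (\<exists>C\<in>{W1 + W2, W1 + W4, W2 + W4}. nabla_omega_zero atlas \<Gamma> g I \<and>
         nabla_omega_in atlas \<Gamma> g J (W1 + W2 + W4) \<and> nabla_omega_in atlas \<Gamma> g K (C + W3)) \<or>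
      (nabla_omega_zero atlas \<Gamma> g I \<and> nabla_omega_in atlas \<Gamma> g J (W1 + W3 + W4) \<and>
         nabla_omega_in atlas \<Gamma> g K (W2 + W3 + W4))
      \<longrightarrow> hyperkaehler atlas \<Gamma> g I J K)
    \<and>
     (DIM('e) = 8 \<longrightarrow>
      (nabla_omega_in atlas \<Gamma> g I W1 \<and> nabla_omega_in atlas \<Gamma> g J W3) \<or>
      (nabla_omega_zero atlas \<Gamma> g I \<and> nabla_omega_in atlas \<Gamma> g J (W1 + W3)) \<or>
      (nabla_omega_zero atlas \<Gamma> g I \<and> nabla_omega_in atlas \<Gamma> g J (W1 + W2 + W3) \<and>
         nabla_omega_in atlas \<Gamma> g K (W1 + W3 + W4))
      \<longrightarrow> hyperkaehler atlas \<Gamma> g I J K)"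
    (is "(?general \<longrightarrow> _) \<and> (_ \<longrightarrow> ?dim8 \<longrightarrow> _)")
proof (intro conjI impI)
  interpret almost_hyper_hermitian M atlas g I J K by (rule assms(1))
  have dim: "4 < DIM('e)" using assms(2,3) by simp
  assume hyp: ?general
  show "hyperkaehler atlas \<Gamma> g I J K"
  proof (rule hyperkaehlerI[OF assms(4)])
    fix c x S T U
    assume cx: "c \<in> atlas" "x \<in> chart_image c"
    have in_pt: "nabla \<Gamma> (omega g A) c x \<in> W (g c x) (A c x)" if "nabla_omega_in atlas \<Gamma> g A W" for A W
      using that cx by (simp add: nabla_omega_in_def)
    have zero_pt: "\<forall>X Y Z. nabla \<Gamma> (omega g A) c x X Y Z = 0" if "nabla_omega_zero atlas \<Gamma> g A" for A
      using that cx by (simp add: nabla_omega_zero_def)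
    assume t: "torsion_form (g c x) (I c x) (J c x) (K c x) (nabla \<Gamma> (omega g I) c x)
      (nabla \<Gamma> (omega g J) c x) (nabla \<Gamma> (omega g K) c x) S T U"
    \<comment> \<open>The hypotheses of \<open>flat_pointwise\<close> have the same shape as
      \<open>hyp\<close>, so each global condition is replaced in place by its value at the
      point.\<close>
    show "torsion_form.flat (nabla \<Gamma> (omega g I) c x)
      (nabla \<Gamma> (omega g J) c x) (nabla \<Gamma> (omega g K) c x)"
      using hyp
      by (intro torsion_form.flat_pointwise[OF t dim])
        (elim disj_forward conj_forward bex_forward; (erule in_pt zero_pt | assumption))
  qed
next
  interpret almost_hyper_hermitian M atlas g I J K by (rule assms(1))
  assume dim: "DIM('e) = 8" and hyp: ?dim8
  show "hyperkaehler atlas \<Gamma> g I J K"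
  proof (rule hyperkaehlerI[OF assms(4)])
    fix c x S T U
    assume cx: "c \<in> atlas" "x \<in> chart_image c"
    have in_pt: "nabla \<Gamma> (omega g A) c x \<in> W (g c x) (A c x)" if "nabla_omega_in atlas \<Gamma> g A W" for A W
      using that cx by (simp add: nabla_omega_in_def)
    have zero_pt: "\<forall>X Y Z. nabla \<Gamma> (omega g A) c x X Y Z = 0" if "nabla_omega_zero atlas \<Gamma> g A" for A
      using that cx by (simp add: nabla_omega_zero_def)
    assume t: "torsion_form (g c x) (I c x) (J c x) (K c x) (nabla \<Gamma> (omega g I) c x)
      (nabla \<Gamma> (omega g J) c x) (nabla \<Gamma> (omega g K) c x) S T U"
    show "torsion_form.flat (nabla \<Gamma> (omega g I) c x)
      (nabla \<Gamma> (omega g J) c x) (nabla \<Gamma> (omega g K) c x)"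
      using hyp
      by (intro torsion_form.flat_pointwise_dim8[OF t dim])
        (elim disj_forward conj_forward bex_forward; (erule in_pt zero_pt | assumption))
  qed
qed

end
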